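(* Let $p$ be an odd prime with $p \equiv 2 \pmod 3$. Consider the following algorithm. (1) Form the list, in ascending order of Mahler measure, of all irreducible, non-cyclotomic cubic polynomials in $\mathbb{Z}[x]$ with Mahler measure less than $8.5$; let $f$ be the first polynomial on the list. (2) Write $f(x) = ax^3+bx^2+cx+d$, put it in depressed form $g(x) = x^3+Ax+B$ with $A = \frac{3ac-b^2}{3a^2}$, $B = \frac{27a^2d - 9abc + 2b^3}{27a^3}$, and let $\Delta = B^2+4A^3/27$. (3) If $\Delta$ is a square in $\mathbb{Q}_p$ or is not a square in $\mathbb{Q}_p(\sqrt{-3})$, return to step (2) with the next polynomial on the list. (4) If $A=0$ let $C=-B$, and otherwise let $C$ be a square root of $\Delta$ in $\mathbb{Q}_p(\sqrt{-3})$. If $\frac{-B+C}{2}$ is not a cube in $\mathbb{Q}_p(\sqrt{-3})$, return to step (2) with the next polynomial on the list. (5) If $\frac{-B+C}{2}$ is a cube in $\mathbb{Q}_p$, return to step (2) with the next polynomial on the list; otherwise terminate and output $\frac{1}{3}\log M(f)$. Then this algorithm terminates, and its output equals $\tau_{3,p}$.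
   Context: For a polynomial $f(x) = a\prod_{i}(x-\alpha_i) \in \mathbb{C}[x]$, the Mahler measure is $M(f) = |a|\prod_i \max(1,|\alpha_i|)$. For an algebraic number $\alpha$ of degree $d$ with (primitive) minimal polynomial $f_\alpha \in \mathbb{Z}[x]$, its logarithmic Weil height is $h(\alpha) = \frac{1}{d}\log M(f_\alpha)$. An algebraic number is totally $p$-adic if its minimal polynomial splits completely over $\mathbb{Q}_p$. $\tau_{3,p}$ denotes the smallest height attained by a totally $p$-adic algebraic number of degree $3$ that is nonzero and not a root of unity. *)

theory Defs
  imports
    "HOL-Analysis.Analysis"
    "HOL-Algebra.Algebraic_Closure_Type"
    "Berlekamp_Zassenhaus.Mahler_Measure"
begin

hide_const (open) Divisibility.irreducible Divisibility.prime UnivPoly.coeff Module.smult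
  Polynomials.degree Polynomials.lead_coeff

section \<open>The field of p-adic numbers\<close>

text \<open>
  The prime is the cardinality of a type \<open>'p\<close> of class \<^class>\<open>prime_card\<close>. The ring of p-adic
  integers is the inverse limit of the rings of integers modulo \<open>p ^ n\<close>; an element is stored as
  the sequence of its least non-negative residues.
\<close>

typedef (overloaded) 'p::prime_card padic_int =
  "{x :: nat \<Rightarrow> int. \<forall>n. x n \<in> {0..<int CARD('p) ^ n} \<and> x (Suc n) mod int CARD('p) ^ n = x n}"
  by (rule exI[of _ "\<lambda>_. 0"]) (simp add: prime_card prime_gt_0_nat)

setup_lifting type_definition_padic_int

lemma padic_seq_lift:
  fixes f :: "nat \<Rightarrow> int"
  assumes "\<And>n. f (Suc n) mod int CARD('p::prime_card) ^ n = f n mod int CARD('p) ^ n"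
  shows "f n mod int CARD('p) ^ n \<in> {0..<int CARD('p) ^ n} \<and>
             (f (Suc n) mod int CARD('p) ^ Suc n) mod int CARD('p) ^ n = f n mod int CARD('p) ^ n"
proof
  have "0 < int CARD('p)"
    using prime_card[where 'a='p] prime_gt_0_nat by simp
  then show "f n mod int CARD('p) ^ n \<in> {0..<int CARD('p) ^ n}"
    by simp
  have "(f (Suc n) mod int CARD('p) ^ Suc n) mod int CARD('p) ^ n = f (Suc n) mod int CARD('p) ^ n"
    by (rule mod_mod_cancel) simp
  then show "(f (Suc n) mod int CARD('p) ^ Suc n) mod int CARD('p) ^ n = f n mod int CARD('p) ^ n"
    using assms by simp
qed

instantiation padic_int :: (prime_card) comm_ring_1
begin

lift_definition zero_padic_int :: "'a padic_int" is "\<lambda>_. 0"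
  by (simp add: prime_card prime_gt_0_nat)

lift_definition one_padic_int :: "'a padic_int" is "\<lambda>n. 1 mod int CARD('a) ^ n"
  by (rule padic_seq_lift) simp

lift_definition plus_padic_int :: "'a padic_int \<Rightarrow> 'a padic_int \<Rightarrow> 'a padic_int"
  is "\<lambda>x y n. (x n + y n) mod int CARD('a) ^ n"
  by (rule padic_seq_lift) (metis mod_add_eq)

lift_definition uminus_padic_int :: "'a padic_int \<Rightarrow> 'a padic_int"
  is "\<lambda>x n. (- x n) mod int CARD('a) ^ n"
  by (rule padic_seq_lift) (metis mod_minus_eq)

lift_definition minus_padic_int :: "'a padic_int \<Rightarrow> 'a padic_int \<Rightarrow> 'a padic_int"
  is "\<lambda>x y n. (x n - y n) mod int CARD('a) ^ n"
  by (rule padic_seq_lift) (metis mod_diff_eq)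

lift_definition times_padic_int :: "'a padic_int \<Rightarrow> 'a padic_int \<Rightarrow> 'a padic_int"
  is "\<lambda>x y n. (x n * y n) mod int CARD('a) ^ n"
  by (rule padic_seq_lift) (metis mod_mult_eq)

instance
proof
  fix a b c :: "'a padic_int"
  show "a + b + c = a + (b + c)"
    by transfer (simp add: mod_simps add.assoc)
  show "a + b = b + a"
    by transfer (simp add: add.commute)
  show "0 + a = a"
    by transfer auto
  show "- a + a = 0"
    by transfer (simp add: mod_simps)
  show "a - b = a + - b"
    by transfer (simp add: mod_simps)
  show "a * b * c = a * (b * c)"
    by transfer (simp add: mod_simps mult.assoc)
  show "a * b = b * a"
    by transfer (simp add: mult.commute)
  show "1 * a = a"
    by transfer (auto simp: mod_simps)
  show "(a + b) * c = a * c + b * c"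
    by transfer (simp add: mod_simps distrib_right)
  show "(0 :: 'a padic_int) \<noteq> 1"
  proof
    assume "(0 :: 'a padic_int) = 1"
    then have "(0 :: int) = 1 mod int CARD('a) ^ 1"
      by transfer (rule fun_cong)
    then show False
      using prime_card[where 'a='a] prime_gt_1_nat by simp
  qed
qed

end

lemma padic_int_mod:
  assumes "\<forall>n. x n \<in> {0..<int p ^ n} \<and> x (Suc n) mod int p ^ n = x n"
  shows "x (n + k) mod int p ^ n = x n"
proof (induction k)
  case 0
  then show ?case
    using assms by auto
next
  case (Suc k)
  have "x (n + Suc k) mod int p ^ n = (x (Suc (n + k)) mod int p ^ (n + k)) mod int p ^ n"
    by (simp add: mod_mod_cancel le_imp_power_dvd)
  also have "\<dots> = x n"
    using Suc assms by simp
  finally show ?case .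
qed

lemma prime_power_add_dvd_mult:
  fixes p a b :: int
  assumes "prime p" "p ^ (m + n) dvd a * b"
  shows "p ^ m dvd a \<or> p ^ n dvd b"
proof (cases "a = 0 \<or> b = 0")
  case False
  have "\<not> is_unit p" using not_prime_unit[of p] assms(1) by blast
  with False have "m + n \<le> multiplicity p (a * b)"
    by (intro multiplicity_geI assms(2)) auto
  also have "\<dots> = multiplicity p a + multiplicity p b"
    using False prime_imp_prime_elem[OF assms(1)]
    by (simp add: prime_elem_multiplicity_mult_distrib)
  finally have "m \<le> multiplicity p a \<or> n \<le> multiplicity p b"
    by linarith
  then show ?thesis
    by (metis multiplicity_dvd')
qed auto

instance padic_int :: (prime_card) idom
proof
  fix a b :: "'a padic_int"
  assume "a \<noteq> 0" "b \<noteq> 0"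
  then show "a * b \<noteq> 0"
  proof transfer
    fix x y :: "nat \<Rightarrow> int"
    let ?p = "int CARD('a)"
    assume x: "\<forall>n. x n \<in> {0..<?p ^ n} \<and> x (Suc n) mod ?p ^ n = x n"
      and y: "\<forall>n. y n \<in> {0..<?p ^ n} \<and> y (Suc n) mod ?p ^ n = y n"
      and "x \<noteq> (\<lambda>_. 0)" "y \<noteq> (\<lambda>_. 0)"
    then obtain m n where mn: "x m \<noteq> 0" "y n \<noteq> 0"
      by blast
    have "\<not> ?p ^ m dvd x (m + n)" "\<not> ?p ^ n dvd y (m + n)"
      using mn padic_int_mod[OF x, of m n] padic_int_mod[OF y, of n m]
      unfolding add.commute[of n m] by (simp_all only: dvd_eq_mod_eq_0 not_False_eq_True)
    then have "\<not> ?p ^ (m + n) dvd x (m + n) * y (m + n)"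
      using prime_power_add_dvd_mult[OF prime_card_int, of m n "x (m + n)" "y (m + n)"] by blast
    then have "x (m + n) * y (m + n) mod ?p ^ (m + n) \<noteq> 0"
      by (simp only: dvd_eq_mod_eq_0 not_False_eq_True)
    then show "(\<lambda>n. x n * y n mod ?p ^ n) \<noteq> (\<lambda>_. 0)"
      by (rule contrapos_nn) (rule fun_cong)
  qed
qed

lemma Rep_padic_int_of_nat:
  "Rep_padic_int (of_nat k :: 'p::prime_card padic_int) n = int k mod int CARD('p) ^ n"
proof (induction k)
  case 0
  then show ?case
    by (simp add: zero_padic_int.rep_eq)
next
  case (Suc k)
  then show ?case
    by (simp add: plus_padic_int.rep_eq one_padic_int.rep_eq mod_simps)
qed

instance padic_int :: (prime_card) ring_char_0
proof
  show "inj (of_nat :: nat \<Rightarrow> 'a padic_int)"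
  proof (rule injI)
    fix i j :: nat
    assume eq: "(of_nat i :: 'a padic_int) = of_nat j"
    have "1 < CARD('a)"
      using prime_card[where 'a='a] prime_gt_1_nat by blast
    then have lt: "i + j < CARD('a) ^ (i + j)"
      by (intro power_gt_expt) (simp only: One_nat_def)
    have "int i mod int CARD('a) ^ (i + j) = int j mod int CARD('a) ^ (i + j)"
      using eq Rep_padic_int_of_nat[where 'p='a] by metis
    then have "int (i mod CARD('a) ^ (i + j)) = int (j mod CARD('a) ^ (i + j))"
      by (simp only: zmod_int semiring_1_class.of_nat_power)
    then have "i mod CARD('a) ^ (i + j) = j mod CARD('a) ^ (i + j)"
      by (rule of_nat_eq_iff[THEN iffD1])
    moreover have "i < CARD('a) ^ (i + j)" "j < CARD('a) ^ (i + j)"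
      using lt by linarith+
    ultimately show "i = j"
      by (metis mod_less)
  qed
qed

instance fract :: ("{idom,ring_char_0}") field_char_0
proof
  show "inj (of_nat :: nat \<Rightarrow> 'a fract)"
    by (rule injI) (simp add: of_nat_fract eq_fract)
qed

type_synonym 'p padic = "'p padic_int fract"

text \<open>
  Both fields are taken inside the algebraic closure of the p-adic numbers. The second one is the
  field obtained by adjoining the square roots of -3; either choice of \<open>s\<close> gives the same elements.
\<close>

definition Qp :: "'p::prime_card padic alg_closure set" where
  "Qp = range to_ac"

definition Qp_sqrt_m3 :: "'p::prime_card padic alg_closure set" where
  "Qp_sqrt_m3 = {to_ac a + to_ac b * s | a b s. s\<^sup>2 = -3}"

section \<open>Heights and totally p-adic numbers\<close>

definition min_int_poly :: "complex \<Rightarrow> int poly" where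
  "min_int_poly \<alpha> = (THE f. poly (map_poly of_int f) \<alpha> = 0 \<and> f \<noteq> 0 \<and>
     (\<forall>g. g \<noteq> 0 \<and> poly (map_poly of_int g) \<alpha> = 0 \<longrightarrow> degree f \<le> degree g) \<and>
     content f = 1 \<and> lead_coeff f > 0)"

definition alg_degree :: "complex \<Rightarrow> nat" where
  "alg_degree \<alpha> = degree (min_int_poly \<alpha>)"

definition weil_height :: "complex \<Rightarrow> real" where
  "weil_height \<alpha> = 1 / real (alg_degree \<alpha>) * ln (mahler_measure (min_int_poly \<alpha>))"

definition splits_completely :: "'a::field poly \<Rightarrow> bool" where
  "splits_completely f \<longleftrightarrow> (\<exists>c rs. f = smult c (\<Prod>r\<leftarrow>rs. [:- r, 1:]))"

definition totally_padic :: "'p::prime_card itself \<Rightarrow> complex \<Rightarrow> bool" where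
  "totally_padic _ \<alpha> \<longleftrightarrow>
     algebraic \<alpha> \<and> splits_completely (map_poly of_int (min_int_poly \<alpha>) :: 'p padic poly)"

definition root_of_unity :: "complex \<Rightarrow> bool" where
  "root_of_unity \<alpha> \<longleftrightarrow> (\<exists>n>0. \<alpha> ^ n = 1)"

definition tau :: "'p::prime_card itself \<Rightarrow> nat \<Rightarrow> real" where
  "tau P d = (LEAST h. \<exists>\<alpha>. totally_padic P \<alpha> \<and> alg_degree \<alpha> = d \<and>
     \<alpha> \<noteq> 0 \<and> \<not> root_of_unity \<alpha> \<and> h = weil_height \<alpha>)"

section \<open>The algorithm\<close>

definition cyclotomic_poly :: "nat \<Rightarrow> complex poly" where
  "cyclotomic_poly n = (\<Prod>k | k \<in> {1..n} \<and> gcd k n = 1. [:- cis (2 * pi * real k / real n), 1:])"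

text \<open>Polynomials in \<open>\<int>[x]\<close> are not normalised, so cyclotomic is understood up to sign.\<close>

definition is_cyclotomic :: "int poly \<Rightarrow> bool" where
  "is_cyclotomic f \<longleftrightarrow> (\<exists>n>0. map_poly of_int f \<in> {cyclotomic_poly n, - cyclotomic_poly n})"

definition candidate_cubics :: "int poly set" where
  "candidate_cubics =
     {f. degree f = 3 \<and> irreducible f \<and> \<not> is_cyclotomic f \<and> mahler_measure f < 8.5}"

text \<open>Polynomials of equal Mahler measure may be listed in any order.\<close>

definition ascending_list :: "int poly list \<Rightarrow> bool" where
  "ascending_list fs \<longleftrightarrow>
     set fs = candidate_cubics \<and> distinct fs \<and> sorted (map mahler_measure fs)"

definition depressed_A :: "int poly \<Rightarrow> rat" where
  "depressed_A f = (let a = of_int (coeff f 3); b = of_int (coeff f 2); c = of_int (coeff f 1)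
     in (3 * a * c - b\<^sup>2) / (3 * a\<^sup>2))"

definition depressed_B :: "int poly \<Rightarrow> rat" where
  "depressed_B f = (let a = of_int (coeff f 3); b = of_int (coeff f 2); c = of_int (coeff f 1);
       d = of_int (coeff f 0)
     in (27 * a\<^sup>2 * d - 9 * a * b * c + 2 * b ^ 3) / (27 * a ^ 3))"

definition Delta :: "int poly \<Rightarrow> rat" where
  "Delta f = (depressed_B f)\<^sup>2 + 4 * (depressed_A f) ^ 3 / 27"

definition is_square_in :: "'a::field set \<Rightarrow> 'a \<Rightarrow> bool" where
  "is_square_in K x \<longleftrightarrow> (\<exists>y\<in>K. y\<^sup>2 = x)"

definition is_cube_in :: "'a::field set \<Rightarrow> 'a \<Rightarrow> bool" where
  "is_cube_in K x \<longleftrightarrow> (\<exists>y\<in>K. y ^ 3 = x)"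

text \<open>
  \<open>C\<close> may be either of the two square roots; the choices made by a run of the algorithm are recorded
  in a function \<open>rt\<close>, which the theorem quantifies universally.
\<close>

definition sqrt_choice :: "(int poly \<Rightarrow> 'p::prime_card padic alg_closure) \<Rightarrow> bool" where
  "sqrt_choice rt \<longleftrightarrow> (\<forall>f. is_square_in Qp_sqrt_m3 (of_rat (Delta f) :: 'p padic alg_closure) \<longrightarrow>
     rt f \<in> Qp_sqrt_m3 \<and> (rt f)\<^sup>2 = of_rat (Delta f))"

text \<open>The result \<open>None\<close> means that the list was exhausted without any output.\<close>

primrec algorithm ::
    "(int poly \<Rightarrow> 'p::prime_card padic alg_closure) \<Rightarrow> int poly list \<Rightarrow> real option" where
  "algorithm rt [] = None"
| "algorithm rt (f # fs) =
    (if is_square_in Qp (of_rat (Delta f) :: 'p padic alg_closure) \<or>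
        \<not> is_square_in Qp_sqrt_m3 (of_rat (Delta f) :: 'p padic alg_closure)
     then algorithm rt fs
     else
       let B = of_rat (depressed_B f);
           C = (if depressed_A f = 0 then - B else rt f);
           x = (- B + C) / 2
       in if \<not> is_cube_in Qp_sqrt_m3 x then algorithm rt fs
          else if is_cube_in Qp x then algorithm rt fs
          else Some (1 / 3 * ln (mahler_measure f)))"

end

theory Submission
  imports "Berlekamp_Zassenhaus.Factor_Bound" Defs
begin

text \<open>
  Cardano's formula turns the steps of the algorithm into a test for complete splitting over
  \<open>\<rat>\<^sub>p\<close>, in which -3 is not a square. If the cubic has three distinct roots there, its
  discriminant \<open>- 27 * \<Delta>\<close> is a nonzero square, so \<open>\<Delta>\<close> is -3 times a square. Conversely a cube
  root \<open>m + n * sqrt (- 3)\<close> of \<open>(- B + C) / 2\<close> expresses the three roots in terms of \<open>m\<close> and \<open>n\<close>.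

  Termination needs, for every \<open>p\<close>, an irreducible cubic of Mahler measure below 8.5 that
  splits. The compositum of the cyclic cubic fields of conductor 7 and 9 has Galois group
  \<open>(\<int>/3)\<^sup>2\<close>, and its Frobenius at \<open>p\<close> acts trivially on at least one of its four cubic subfields. In
  elementary terms, the cubes have index 3 in the unit group of the field with \<open>p\<^sup>2\<close> elements,
  hence one of \<open>w\<^sup>2\<close>, \<open>c\<close>, \<open>w * c\<close>, \<open>w\<^sup>2 * c\<close> is a cube for every unit \<open>c\<close>, where \<open>w\<close> is a primitive cube root of
  unity. This yields a simple root modulo \<open>p\<close> of one of four explicit cubics, which Hensel's lemma
  lifts. The other two roots are its images under a Moebius transformation of order 3.
\<close>

section \<open>Cubes in the field with p squared elements\<close>

lemma mod_ring_card_power: "x ^ CARD('p) = (x :: 'p::prime_card mod_ring)"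
  using finite_field_power_card_eq_same[of x] by simp

lemma of_int_mod_ring_eq_0_iff:
  "(of_int k :: 'p::prime_card mod_ring) = 0 \<longleftrightarrow> int CARD('p) dvd k"
  by (simp add: of_int_eq_0_iff_char_dvd)

lemma ex_of_int_mod_ring: "\<exists>k. (x :: 'p::prime_card mod_ring) = of_int k"
  by (metis of_int_of_nat_eq surj_of_nat_mod_ring)

lemma two_neq_0_mod_ring:
  assumes "odd CARD('p::prime_card)"
  shows "(2 :: 'p mod_ring) \<noteq> 0"
proof
  assume "(2 :: 'p mod_ring) = 0"
  then have "int CARD('p) dvd 2"
    using of_int_mod_ring_eq_0_iff[where 'p='p, of 2] by simp
  then have "CARD('p) dvd 2" by presburger
  then have "CARD('p) = 2"
    using prime_card[where 'a='p] primes_dvd_imp_eq[of "CARD('p)" 2] by simp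
  then show False
    using assms by simp
qed

lemma three_neq_0_mod_ring:
  assumes "[CARD('p::prime_card) = 2] (mod 3)"
  shows "(3 :: 'p mod_ring) \<noteq> 0"
proof
  assume "(3 :: 'p mod_ring) = 0"
  then have "int CARD('p) dvd 3"
    using of_int_mod_ring_eq_0_iff[where 'p='p, of 3] by simp
  then have "CARD('p) dvd 3" by presburger
  then have "CARD('p) = 3"
    using prime_card[where 'a='p] primes_dvd_imp_eq[of "CARD('p)" 3] by simp
  then show False using assms by (simp add: Cong.cong_def)
qed

text \<open>A root would satisfy \<open>x ^ 3 = 1\<close>. As \<open>CARD('p) = 3 * k + 2\<close>,
  Fermat's theorem gives \<open>x = x\<^sup>2\<close>, so \<open>x\<close> is 0 or 1, and neither is
  a root because 3 is nonzero.\<close>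

lemma no_primitive_cube_root_mod_ring:
  fixes x :: "'p::prime_card mod_ring"
  assumes "[CARD('p) = 2] (mod 3)"
  shows "x\<^sup>2 + x + 1 \<noteq> 0"
proof
  assume x: "x\<^sup>2 + x + 1 = 0"
  have "x ^ 3 - 1 = (x - 1) * (x\<^sup>2 + x + 1)"
    by (simp add: algebra_simps power2_eq_square power3_eq_cube)
  then have x3: "x ^ 3 = 1" using x by simp
  define k where "k = CARD('p) div 3"
  have "CARD('p) mod 3 = 2" using assms by (simp add: Cong.cong_def)
  then have k: "CARD('p) = 3 * k + 2" unfolding k_def by presburger
  have "x = x ^ CARD('p)" by (simp add: mod_ring_card_power)
  also have "\<dots> = x\<^sup>2" unfolding k power_add power_mult x3 by simp
  finally have "x = 1 \<or> x = 0" by (auto simp add: power2_eq_square)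
  then show False using x three_neq_0_mod_ring[OF assms] by auto
qed

text \<open>If \<open>b\<close> were nonzero, \<open>a / b\<close> would be a square root of -3 and
  \<open>(a / b - 1) / 2\<close> a primitive cube root of unity in the prime field.\<close>

lemma square_add_3_square_eq_0_mod_ring:
  fixes a b :: "'p::prime_card mod_ring"
  assumes "odd CARD('p)" "[CARD('p) = 2] (mod 3)" "a\<^sup>2 + 3 * b\<^sup>2 = 0"
  shows "a = 0 \<and> b = 0"
proof (cases "b = 0")
  case False
  define x where "x = (a / b - 1) / 2"
  have t: "(a / b)\<^sup>2 = -3"
    using assms(3) False by (simp add: field_simps eq_neg_iff_add_eq_0)
  have 2: "(2 :: 'p mod_ring) \<noteq> 0" by (rule two_neq_0_mod_ring[OF assms(1)])
  have "2 * x + 1 = a / b" proof -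
    have "2 * x = a / b - 1" unfolding x_def using nonzero_mult_div_cancel_left[OF 2]
      by (metis times_divide_eq_right)
    then show ?thesis by simp
  qed
  then have "(2 * x + 1)\<^sup>2 + 3 = 0" using t by simp
  then have "2 * 2 * (x\<^sup>2 + x + 1) = 0"
    by (simp add: algebra_simps power2_eq_square)
  then have "x\<^sup>2 + x + 1 = 0" using 2 by (metis mult_eq_0_iff)
  then show ?thesis using no_primitive_cube_root_mod_ring[OF assms(2)] by blast
qed (use assms(3) in simp)

text \<open>The fibres of cubing have at most three elements, so the set \<open>S\<close> of cubes
  has index at most 3 in the group \<open>G\<close>. If \<open>w\<^sup>2\<close> is not a cube,
  neither is \<open>w\<close>, and the cosets of \<open>S\<close> by 1, \<open>w\<close> and
  \<open>w\<^sup>2\<close> are disjoint and fill \<open>G\<close>. Then \<open>c\<close> times a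
  suitable power of \<open>w\<close> lies in \<open>S\<close>.\<close>

lemma ex_cube_in_coset:
  fixes w c :: "'a::field"
  assumes "finite G" "0 \<notin> G" and divide: "\<And>x y. x \<in> G \<Longrightarrow> y \<in> G \<Longrightarrow> x / y \<in> G"
    and w: "w \<in> G" "w\<^sup>2 + w + 1 = 0" "w \<noteq> 1" and c: "c \<in> G"
  shows "\<exists>x\<in>G. x ^ 3 \<in> {w\<^sup>2, c, w * c, w\<^sup>2 * c}"
proof (rule ccontr)
  assume *: "\<not> ?thesis"
  define S where "S = (\<lambda>x. x ^ 3) ` G"
  have S: "finite S" "0 \<notin> S" using assms(1,2) by (auto simp: S_def)
  have divS: "x / y \<in> S" if "x \<in> S" "y \<in> S" for x y
    using that divide unfolding S_def by (auto simp flip: power_divide)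
  \<comment> \<open>Multiplication by \<open>y\<close> is division by its inverse
    \<open>(y / y) / y\<close>.\<close>
  have mult: "x * y \<in> G" if "x \<in> G" "y \<in> G" for x y
    using divide[OF that(1) divide[OF divide[OF that(2) that(2)] that(2)]] that assms(2)
    by (auto simp: field_simps split: if_splits)
  have "w ^ 3 - 1 = (w - 1) * (w\<^sup>2 + w + 1)"
    by (simp add: algebra_simps power2_eq_square power3_eq_cube)
  then have w3: "w ^ 3 = 1" using w(2) by simp
  have w0: "w \<noteq> 0" using w(1) assms(2) by blast
  have notS: "w\<^sup>2 \<notin> S" "c \<notin> S" "w * c \<notin> S" "w\<^sup>2 * c \<notin> S"
    using * by (auto simp: S_def)
  have one: "1 \<in> S" proof -
    have "c ^ 3 \<in> S" "c \<noteq> 0" using c assms(2) by (auto simp: S_def)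
    then show ?thesis using divS[of "c ^ 3" "c ^ 3"] by simp
  qed
  have "w \<notin> S"
  proof
    assume "w \<in> S"
    then have "1 / w \<in> S" using divS one by blast
    moreover have "1 / w = w\<^sup>2" using w3 w0 by (simp add: field_simps power2_eq_square power3_eq_cube)
    ultimately show False using notS by simp
  qed
  define T where "T = (\<lambda>i s. w ^ i * s)"
  have disj: "i = j" if "i < 3" "j < 3" "T i ` S \<inter> T j ` S \<noteq> {}" for i j :: nat
  proof (rule ccontr)
    assume "i \<noteq> j"
    then show False using that
    proof (induction i j rule: linorder_wlog)
      case (le i j)
      then obtain s t where st: "s \<in> S" "t \<in> S" "w ^ i * s = w ^ j * t" by (auto simp: T_def)
      have "w ^ j = w ^ i * w ^ (j - i)" using le by (simp flip: power_add)
      then have "s = w ^ (j - i) * t" using st(3) w0 by simp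
      then have "w ^ (j - i) = s / t" using st(2) S(2) by auto
      then have "w ^ (j - i) \<in> S" using divS st by simp
      moreover have "j - i = 1 \<or> j - i = 2" using le by linarith
      ultimately show False using \<open>w \<notin> S\<close> notS(1) by auto
    qed (metis Int_commute)
  qed
  have cardT: "card (T i ` S) = card S" for i
    by (rule card_image) (auto simp: T_def inj_on_def w0)
  have TG: "T i ` S \<subseteq> G" if "i < 3" for i
  proof -
    have "x ^ 3 \<in> G" if "x \<in> G" for x
      using mult that by (simp add: power3_eq_cube)
    then have "S \<subseteq> G" by (auto simp: S_def)
    moreover have "w ^ i * s \<in> G" if "s \<in> G" for s
      by (induction i) (use that mult w(1) in \<open>auto simp: mult.assoc\<close>)
    ultimately show ?thesis by (auto simp: T_def)
  qed
  have "card G \<le> 3 * card S"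
  proof -
    \<comment> \<open>Once a fibre contains \<open>y\<close>, the factorisation of
      \<open>x ^ 3 - y ^ 3\<close> confines it to \<open>y\<close>, \<open>w * y\<close> and
      \<open>w\<^sup>2 * y\<close>.\<close>
    have fibre: "card {x \<in> G. x ^ 3 = s} \<le> 3" if s: "s \<in> S" for s
    proof -
      obtain y where y: "s = y ^ 3" using s by (auto simp: S_def)
      have "x ^ 3 - y ^ 3 = (x - y) * (x - w * y) * (x - w\<^sup>2 * y)" for x
      proof -
        have "(x - w * y) * (x - w\<^sup>2 * y) = x\<^sup>2 - (w\<^sup>2 + w) * (x * y) + w ^ 3 * y\<^sup>2"
          by (simp add: algebra_simps power2_eq_square power3_eq_cube)
        also have "\<dots> = x\<^sup>2 + x * y + y\<^sup>2"
          using w(2) w3 by (simp add: eq_neg_iff_add_eq_0[symmetric])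
        finally show ?thesis
          by (simp add: mult.assoc) (simp add: algebra_simps power2_eq_square power3_eq_cube)
      qed
      then have "{x \<in> G. x ^ 3 = s} \<subseteq> {y, w * y, w\<^sup>2 * y}"
        by (auto simp: y) (metis cancel_comm_monoid_add_class.diff_cancel eq_iff_diff_eq_0 mult_eq_0_iff)
      then have "card {x \<in> G. x ^ 3 = s} \<le> card {y, w * y, w\<^sup>2 * y}"
        by (rule card_mono[rotated]) simp
      also have "\<dots> \<le> 3" by (simp add: card_insert_if)
      finally show ?thesis .
    qed
    have "card G = card (\<Union>s\<in>S. {x \<in> G. x ^ 3 = s})"
      by (rule arg_cong[of _ _ card]) (auto simp: S_def)
    also have "\<dots> \<le> (\<Sum>s\<in>S. card {x \<in> G. x ^ 3 = s})"
      by (rule card_UN_le[OF S(1)])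
    also have "\<dots> \<le> (\<Sum>s\<in>S. 3)" by (rule sum_mono) (rule fibre)
    finally show ?thesis by simp
  qed
  also have "\<dots> = (\<Sum>i<3. card (T i ` S))" by (simp add: cardT)
  also have "\<dots> = card (\<Union>i\<in>{..<3::nat}. T i ` S)"
    by (rule card_UN_disjoint[symmetric]) (use S disj in auto)
  finally have "(\<Union>i\<in>{..<3::nat}. T i ` S) = G"
    using TG assms(1) by (intro card_seteq) auto
  then obtain i s where i: "i < 3" "s \<in> S" "c = w ^ i * s"
    using c by (auto simp: T_def)
  \<comment> \<open>For positive \<open>i\<close>, multiplying \<open>c\<close> by
    \<open>w ^ (3 - i)\<close> leaves the cube \<open>s\<close>, because
    \<open>w ^ 3 = 1\<close>.\<close>
  have "i = 0 \<or> i = 1 \<or> i = 2" using i(1) by linarith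
  then show False
  proof (elim disjE)
    assume "i = 0" then show False using i notS by simp
  next
    assume "i = 1"
    then have "w\<^sup>2 * c = w ^ 3 * s" using i(3) by (simp add: power2_eq_square power3_eq_cube)
    then have "w\<^sup>2 * c = s" by (simp only: w3 mult_1_left)
    then show False using i(2) notS(4) by metis
  next
    assume "i = 2"
    then have "w * c = w ^ 3 * s" using i(3) by (simp add: power2_eq_square power3_eq_cube)
    then have "w * c = s" by (simp only: w3 mult_1_left)
    then show False using i(2) notS(3) by metis
  qed
qed

section \<open>The family of cyclic cubics and its roots modulo the prime\<close>

text \<open>
  The roots of this polynomial are permuted cyclically by \<open>x \<mapsto> - 1 / (1 + x)\<close>. Its
  discriminant is the square of \<open>b\<^sup>2 - 3 * a * b + 9 * a\<^sup>2\<close>.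
\<close>

definition cyclic_cubic :: "int \<Rightarrow> int \<Rightarrow> int poly" where
  "cyclic_cubic a b = [:- a, b - 3 * a, b, a:]"

lemma poly_cyclic_cubic:
  "poly (of_int_poly (cyclic_cubic a b)) (x :: 'a::comm_ring_1) =
    of_int a * x ^ 3 + of_int b * x\<^sup>2 + (of_int b - 3 * of_int a) * x - of_int a"
  by (simp add: cyclic_cubic_def hom_distribs algebra_simps power2_eq_square power3_eq_cube)

text \<open>
  The transformation \<open>x \<mapsto> (x - w) / (x - w\<^sup>2)\<close> turns the equation into one of the form
  \<open>y ^ 3 = t\<close>. The rational solution is \<open>x = (m - n) / n\<close>, which makes
  \<open>(m + n * w) * (x - w)\<close> an element of the ground field.
\<close>

lemma cyclic_cubic_root_from_cube:
  fixes w :: "'p::prime_card mod_ring alg_closure" and m n :: "'p mod_ring"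
  assumes indep: "\<And>x y. to_ac x + to_ac y * w = 0 \<Longrightarrow> x = 0 \<and> y = 0"
    and w: "w\<^sup>2 + w + 1 = 0"
    and cube: "(to_ac m + to_ac n * w) ^ 3 = of_int P + of_int Q * w"
    and rel: "b * Q = 3 * a * (Q - P)" and "(of_int Q :: 'p mod_ring) \<noteq> 0" and "(3 :: 'p mod_ring) \<noteq> 0"
  shows "\<exists>x :: 'p mod_ring. poly (of_int_poly (cyclic_cubic a b)) x = 0"
proof -
  have ww: "w * w = - w - 1" using w by (simp add: power2_eq_square eq_neg_iff_add_eq_0 algebra_simps)
  \<comment> \<open>The same relation inside a longer product; both together reduce powers of
    \<open>w\<close> to the basis 1, \<open>w\<close>.\<close>
  have www: "w * (w * x) = - (w * x) - x" for x
    using ww by (metis (no_types, opaque_lifting) left_diff_distrib mult.assoc mult_1 mult_minus_left)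
  have "to_ac (m ^ 3 + n ^ 3 - 3 * m * n\<^sup>2 - of_int P) +
      to_ac (3 * m\<^sup>2 * n - 3 * m * n\<^sup>2 - of_int Q) * w = (to_ac m + to_ac n * w) ^ 3 - (of_int P + of_int Q * w)"
    by (simp add: algebra_simps power2_eq_square power3_eq_cube ww www)
  also have "\<dots> = 0" using cube by simp
  finally have PQ: "of_int P = m ^ 3 + n ^ 3 - 3 * m * n\<^sup>2" "of_int Q = 3 * m\<^sup>2 * n - 3 * m * n\<^sup>2"
    using indep by fastforce+
  have n0: "n \<noteq> 0" using PQ(2) assms(5) by auto
  have "of_int b * of_int Q = (3 * of_int a * (of_int Q - of_int P) :: 'p mod_ring)"
    using arg_cong[OF rel, of "of_int :: int \<Rightarrow> 'p mod_ring"] by simp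
  then have "of_int b * (3 * m\<^sup>2 * n - 3 * m * n\<^sup>2) =
      3 * of_int a * ((3 * m\<^sup>2 * n - 3 * m * n\<^sup>2) - (m ^ 3 + n ^ 3 - 3 * m * n\<^sup>2))"
    by (simp only: PQ)
  then have "3 * (of_int a * (m ^ 3 - 3 * m\<^sup>2 * n + n ^ 3) + of_int b * (m\<^sup>2 * n - m * n\<^sup>2)) = 0"
    by (simp add: algebra_simps)
  then have *: "of_int a * (m ^ 3 - 3 * m\<^sup>2 * n + n ^ 3) + of_int b * (m\<^sup>2 * n - m * n\<^sup>2) = 0"
    using assms(6) by (metis mult_eq_0_iff)
  \<comment> \<open>Clearing the denominator at \<open>(m - n) / n\<close> turns the cubic into the
    form that was just shown to vanish.\<close>
  have "n ^ 3 * poly (of_int_poly (cyclic_cubic a b)) ((m - n) / n) =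
    of_int a * (m ^ 3 - 3 * m\<^sup>2 * n + n ^ 3) + of_int b * (m\<^sup>2 * n - m * n\<^sup>2)"
    using n0 by (simp add: poly_cyclic_cubic field_simps power2_eq_square power3_eq_cube)
  then show ?thesis using * n0 by auto
qed

text \<open>
  The four pairs belong to \<open>w\<^sup>2\<close>, \<open>c\<close>, \<open>w * c\<close> and \<open>w\<^sup>2 * c\<close> with
  \<open>c = 2 + 3 * w\<close> of norm 7. They describe the cubic fields of conductor 9 and 7, and the two of
  conductor 63.
\<close>

lemma ex_root_mod_ring:
  assumes "odd CARD('p::prime_card)" "[CARD('p) = 2] (mod 3)"
  shows "\<exists>(a, b) \<in> {(1, 0), (1, 1), (1, -6), (2, 9)}.
    \<exists>x :: 'p mod_ring. poly (of_int_poly (cyclic_cubic a b)) x = 0"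
proof -
  have 2: "(2 :: 'p mod_ring) \<noteq> 0" by (rule two_neq_0_mod_ring[OF assms(1)])
  have three: "(3 :: 'p mod_ring) \<noteq> 0" by (rule three_neq_0_mod_ring[OF assms(2)])
  have "\<exists>w :: 'p mod_ring alg_closure. poly [:1, 1, 1:] w = 0"
    by (rule alg_closed_imp_poly_has_root) simp
  then obtain w :: "'p mod_ring alg_closure" where w: "w\<^sup>2 + w + 1 = 0"
    by (auto simp: power2_eq_square algebra_simps)
  have ww: "w * w = - w - 1" using w by (simp add: power2_eq_square eq_neg_iff_add_eq_0 algebra_simps)
  have www: "w * (w * x) = - (w * x) - x" for x
    using ww by (metis (no_types, opaque_lifting) left_diff_distrib mult.assoc mult_1 mult_minus_left)
  \<comment> \<open>A dependence would put \<open>w\<close>, a primitive cube root of unity, into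
    the prime field.\<close>
  have indep: "x = 0 \<and> y = 0" if "to_ac x + to_ac y * w = 0" for x y
  proof (cases "y = 0")
    case False
    then have "w = to_ac (- x / y)"
      using that by (simp add: field_simps eq_neg_iff_add_eq_0)
    then have "to_ac ((- x / y)\<^sup>2 + (- x / y) + 1) = 0"
      using w by (simp only: to_ac_add to_ac_power to_ac_1)
    then show ?thesis
      using no_primitive_cube_root_mod_ring[OF assms(2), of "- x / y"] by (simp only: to_ac_eq_0_iff)
  qed (use that in simp)
  have w1: "w \<noteq> 1"
  proof
    assume "w = 1"
    then show False using indep[of "-1" 1] by simp
  qed
  \<comment> \<open>This is the unit group of the field with \<open>CARD('p)\<close> squared
    elements, written in the basis 1, \<open>w\<close>.\<close>
  define G where "G = {to_ac x + to_ac y * w |x y. x \<noteq> 0 \<or> y \<noteq> 0}"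
  have mem: "to_ac x + to_ac y * w \<in> G" if "x \<noteq> 0 \<or> y \<noteq> 0" for x y
    using that by (auto simp: G_def)
  have fin: "finite G"
    by (rule finite_subset[of _ "(\<lambda>(x, y). to_ac x + to_ac y * w) ` UNIV"]) (auto simp: G_def)
  have G0: "0 \<notin> G" using indep by (auto simp: G_def)
  have mult: "u * v \<in> G" if "u \<in> G" "v \<in> G" for u v
  proof -
    obtain x y x' y' where uv: "u = to_ac x + to_ac y * w" "v = to_ac x' + to_ac y' * w"
      using \<open>u \<in> G\<close> \<open>v \<in> G\<close> by (auto simp: G_def)
    have "u * v = to_ac (x * x' - y * y') + to_ac (x * y' + y * x' - y * y') * w"
      unfolding uv by (simp add: algebra_simps ww www)
    moreover have "u * v \<noteq> 0" using that G0 by auto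
    ultimately show ?thesis
      using mem by (metis add_0 mult_zero_left to_ac_0)
  qed
  have inverse: "inverse u \<in> G" if "u \<in> G" for u
  proof -
    obtain x y where u: "u = to_ac x + to_ac y * w" using \<open>u \<in> G\<close> by (auto simp: G_def)
    have u0: "u \<noteq> 0" using that G0 by auto
    \<comment> \<open>The norm of \<open>u\<close>: the conjugate of \<open>x + y * w\<close> is
      \<open>x - y - y * w\<close>, as the other root of the quadratic is
      \<open>- 1 - w\<close>.\<close>
    define N where "N = x\<^sup>2 - x * y + y\<^sup>2"
    have uN: "u * (to_ac (x - y) + to_ac (- y) * w) = to_ac N"
      unfolding u N_def by (simp add: algebra_simps ww www power2_eq_square)
    have "to_ac (x - y) + to_ac (- y) * w \<noteq> 0"
      using indep[of "x - y" "- y"] u0 u by auto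
    then have N0: "to_ac N \<noteq> 0" using uN u0 by (metis mult_eq_0_iff)
    have "inverse u = to_ac ((x - y) / N) + to_ac ((- y) / N) * w"
    proof (rule inverse_unique)
      show "u * (to_ac ((x - y) / N) + to_ac (- y / N) * w) = 1"
        using uN N0 by (simp add: field_simps)
    qed
    then show ?thesis using mem u0 by (metis add_0 mult_zero_left to_ac_0 nonzero_imp_inverse_nonzero)
  qed
  define c where "c = to_ac 2 + to_ac 3 * w"
  have "\<exists>u\<in>G. u ^ 3 \<in> {w\<^sup>2, c, w * c, w\<^sup>2 * c}"
  proof (rule ex_cube_in_coset[OF fin G0 _ _ w w1])
    show "x / y \<in> G" if "x \<in> G" "y \<in> G" for x y
      using mult[OF that(1) inverse[OF that(2)]] by (simp add: field_class.field_divide_inverse)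
    show "w \<in> G" using mem[of 0 1] by simp
    show "c \<in> G" using mem[of 2 3] 2 by (simp add: c_def)
  qed
  then obtain m n where mn: "(to_ac m + to_ac n * w) ^ 3 \<in> {w\<^sup>2, c, w * c, w\<^sup>2 * c}"
    by (auto simp: G_def)
  \<comment> \<open>These coordinates are the pairs \<open>(P, Q)\<close>. Solving
    \<open>b * Q = 3 * a * (Q - P)\<close> in integers with the least positive \<open>a\<close>
    gives the four pairs \<open>(a, b)\<close>.\<close>
  have reps: "w\<^sup>2 = of_int (-1) + of_int (-1) * w" "c = of_int 2 + of_int 3 * w"
    "w * c = of_int (-3) + of_int (-1) * w" "w\<^sup>2 * c = of_int 1 + of_int (-2) * w"
    by (simp_all add: c_def ww www algebra_simps power2_eq_square)
  note root = cyclic_cubic_root_from_cube[OF indep w, of m n]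
  from mn consider "(to_ac m + to_ac n * w) ^ 3 = w\<^sup>2" | "(to_ac m + to_ac n * w) ^ 3 = c"
    | "(to_ac m + to_ac n * w) ^ 3 = w * c" | "(to_ac m + to_ac n * w) ^ 3 = w\<^sup>2 * c" by auto
  then show ?thesis
  proof cases
    case 1
    then show ?thesis unfolding reps(1) using root[of "-1" "-1" 0 1] three by simp
  next
    case 2
    then show ?thesis unfolding reps(2) using root[of 2 3 1 1] three by simp
  next
    case 3
    then show ?thesis unfolding reps(3) using root[of "-3" "-1" "-6" 1] three by simp
  next
    case 4
    then show ?thesis unfolding reps(4) using root[of 1 "-2" 9 2] 2 three by simp
  qed
qed

text \<open>With \<open>f\<close> the cubic, \<open>f' * (x\<^sup>2 + x) = a * (x\<^sup>2 + x +
  1)\<^sup>2 + (2 * x + 1) * f\<close>. A double root would thus be a primitive cube root of unity,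
  since \<open>a\<close> stays nonzero modulo an odd prime. Simplicity of the root is what Hensel
  lifting requires.\<close>

lemma cyclic_cubic_deriv_neq_0:
  fixes x :: "'p::prime_card mod_ring"
  assumes "odd CARD('p::prime_card)" "[CARD('p) = 2] (mod 3)" "a = 1 \<or> a = 2"
    and x: "poly (of_int_poly (cyclic_cubic a b)) x = 0"
  shows "poly (of_int_poly (pderiv (cyclic_cubic a b))) x \<noteq> 0"
proof -
  define A B :: "'p mod_ring" where "A = of_int a" and "B = of_int b"
  have A0: "A \<noteq> 0" using assms(3) two_neq_0_mod_ring[OF assms(1)] by (auto simp: A_def)
  have 0: "A * x ^ 3 + B * x\<^sup>2 + (B - 3 * A) * x - A = 0"
    using x by (simp add: poly_cyclic_cubic A_def B_def)
  have d: "poly (of_int_poly (pderiv (cyclic_cubic a b))) x = 3 * A * x\<^sup>2 + 2 * B * x + (B - 3 * A)"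
    by (simp add: cyclic_cubic_def A_def B_def hom_distribs algebra_simps power2_eq_square pderiv_pCons)
  have "(3 * A * x\<^sup>2 + 2 * B * x + (B - 3 * A)) * (x\<^sup>2 + x) =
     A * (x\<^sup>2 + x + 1)\<^sup>2 + (2 * x + 1) * (A * x ^ 3 + B * x\<^sup>2 + (B - 3 * A) * x - A)"
    by (simp add: algebra_simps power2_eq_square power3_eq_cube)
  then show ?thesis using A0 no_primitive_cube_root_mod_ring[OF assms(2), of x] unfolding d 0 by auto
qed

section \<open>Hensel lifting\<close>

text \<open>Taylor's formula with a remainder divisible by \<open>h\<^sup>2\<close>, which controls
  the error of a Newton step.\<close>

lemma poly_add_expand:
  fixes f :: "'a::idom poly"
  shows "\<exists>q. poly f (x + h) = poly f x + h * poly (pderiv f) x + h\<^sup>2 * q"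
proof (induction f)
  case (pCons a f)
  then obtain q where q: "poly f (x + h) = poly f x + h * poly (pderiv f) x + h\<^sup>2 * q" by blast
  have "poly (pCons a f) (x + h) = poly (pCons a f) x + h * poly (pderiv (pCons a f)) x
      + h\<^sup>2 * (poly (pderiv f) x + (x + h) * q)"
    unfolding poly_pCons q by (simp add: pderiv_pCons algebra_simps power2_eq_square)
  then show ?case by blast
qed simp

lemma cong_poly:
  fixes f :: "int poly"
  assumes "[x = y] (mod m)"
  shows "[poly f x = poly f y] (mod m)"
proof (induction f)
  case (pCons a f)
  have "[a + x * poly f x = a + y * poly f y] (mod m)"
    by (intro Cong.cong_add Cong.cong_mult Cong.cong_refl assms pCons.IH)
  then show ?case by simp
qed simp

text \<open>One Newton step with \<open>h = - poly f x * d\<close>, where \<open>d\<close> inverts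
  the derivative modulo \<open>p\<close>. The linear terms cancel modulo one further power of
  \<open>p\<close>, and \<open>h\<^sup>2\<close> is divisible by \<open>p ^ (2 * n + 2)\<close>,
  which is enough.\<close>

lemma prime_power_root_lift:
  fixes f :: "int poly" and p :: int
  assumes "prime p" "p ^ Suc n dvd poly f x" "\<not> p dvd poly (pderiv f) x"
  shows "\<exists>y. [y = x] (mod p ^ Suc n) \<and> p ^ Suc (Suc n) dvd poly f y"
proof -
  obtain k where k: "poly f x = p ^ Suc n * k" using assms(2) by blast
  have "Rings.coprime p (poly (pderiv f) x)"
    using assms(1,3) by (simp add: prime_imp_coprime)
  then obtain d where d: "[poly (pderiv f) x * d = 1] (mod p)"
    using cong_solve_coprime_int by (metis Rings.coprime_commute)
  define h where "h = - (p ^ Suc n * k * d)"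
  obtain q where q: "poly f (x + h) = poly f x + h * poly (pderiv f) x + h\<^sup>2 * q"
    using poly_add_expand by blast
  have "p ^ Suc n * k + h * poly (pderiv f) x + h\<^sup>2 * q = p ^ Suc n * (k * (1 - poly (pderiv f) x * d) + p ^ Suc n * (k * d)\<^sup>2 * q)"
    unfolding h_def by (simp add: algebra_simps power2_eq_square)
  then have "poly f (x + h) = p ^ Suc n * (k * (1 - poly (pderiv f) x * d) + p ^ Suc n * (k * d)\<^sup>2 * q)"
    unfolding q k .
  moreover have "p dvd 1 - poly (pderiv f) x * d"
    using d by (metis cong_iff_dvd_diff cong_sym)
  then have "p dvd k * (1 - poly (pderiv f) x * d) + p ^ Suc n * (k * d)\<^sup>2 * q"
    by (intro dvd_add dvd_mult dvd_mult2) auto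
  ultimately have "p ^ Suc (Suc n) dvd poly f (x + h)"
    by (metis mult_dvd_mono dvd_refl power_Suc2)
  moreover have "[x + h = x] (mod p ^ Suc n)"
    by (simp add: cong_iff_dvd_diff h_def)
  ultimately show ?thesis by blast
qed

lemma Rep_padic_int_of_int:
  "Rep_padic_int (of_int k :: 'p::prime_card padic_int) n = k mod int CARD('p) ^ n"
proof (cases k)
  case (neg m)
  have "Rep_padic_int (- of_nat (Suc m) :: 'p padic_int) n = k mod int CARD('p) ^ n"
    unfolding uminus_padic_int.rep_eq Rep_padic_int_of_nat neg by (rule mod_minus_eq)
  then show ?thesis by (simp only: neg of_int_minus of_int_of_nat_eq)
qed (simp add: Rep_padic_int_of_nat)

text \<open>Evaluation commutes with reduction, so a p-adic root amounts to a compatible sequence of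
  roots modulo the powers of the prime.\<close>

lemma Rep_padic_int_poly:
  "Rep_padic_int (poly (of_int_poly f) z) n = poly f (Rep_padic_int z n) mod int CARD('p) ^ n"
  for z :: "'p::prime_card padic_int"
proof (induction f)
  case 0
  then show ?case by (simp add: zero_padic_int.rep_eq)
next
  case (pCons a f)
  have "Rep_padic_int (poly (of_int_poly (pCons a f)) z) n =
      Rep_padic_int (of_int a + z * poly (of_int_poly f) z) n"
    by (simp add: hom_distribs)
  also have "\<dots> = poly (pCons a f) (Rep_padic_int z n) mod int CARD('p) ^ n"
    unfolding plus_padic_int.rep_eq times_padic_int.rep_eq Rep_padic_int_of_int pCons.IH poly_pCons
    by (simp only: mod_simps)
  finally show ?case .
qed

lemma hensel_padic_int:
  fixes f :: "int poly"
  assumes "int CARD('p) dvd poly f x" "\<not> int CARD('p) dvd poly (pderiv f) x"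
  shows "\<exists>z :: 'p::prime_card padic_int. poly (of_int_poly f) z = 0"
proof -
  define p where "p = int CARD('p)"
  have p: "prime p" unfolding p_def by (rule prime_card_int)
  have not_dvd: "\<not> p dvd poly (pderiv f) y" if "[y = x] (mod p)" for y
  proof -
    have "[poly (pderiv f) y = poly (pderiv f) x] (mod p)"
      by (rule cong_poly[OF that])
    then show ?thesis using assms(2) cong_dvd_iff p_def by blast
  qed
  \<comment> \<open>Newton iteration by dependent choice. Keeping every term congruent to
    \<open>x\<close> preserves the nonvanishing of the derivative.\<close>
  have "\<exists>s. \<forall>n. ([s n = x] (mod p) \<and> p ^ Suc n dvd poly f (s n)) \<and> [s (Suc n) = s n] (mod p ^ Suc n)"
  proof (rule dependent_nat_choice)
    show "\<exists>y. [y = x] (mod p) \<and> p ^ Suc 0 dvd poly f y"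
      using assms(1) p_def by (intro exI[of _ x]) simp
  next
    fix y n
    assume y: "[y = x] (mod p) \<and> p ^ Suc n dvd poly f y"
    then obtain y' where y': "[y' = y] (mod p ^ Suc n)" "p ^ Suc (Suc n) dvd poly f y'"
      using prime_power_root_lift[OF p _ not_dvd] by blast
    have "[y' = y] (mod p)"
      using y'(1) by (rule cong_dvd_modulus) simp
    then have "[y' = x] (mod p)" using y cong_trans by blast
    with y' show "\<exists>y'. ([y' = x] (mod p) \<and> p ^ Suc (Suc n) dvd poly f y') \<and> [y' = y] (mod p ^ Suc n)"
      by blast
  qed
  then obtain s where s: "\<And>n. p ^ Suc n dvd poly f (s n)" "\<And>n. [s (Suc n) = s n] (mod p ^ Suc n)"
    by blast
  \<comment> \<open>Residue number \<open>n\<close> lives modulo \<open>p ^ n\<close>, while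
    \<open>s n\<close> is a root modulo \<open>p ^ Suc n\<close>; the surplus power is discarded
    below.\<close>
  define z :: "'p padic_int" where "z = Abs_padic_int (\<lambda>n. s n mod p ^ n)"
  have "[s (Suc n) = s n] (mod p ^ n)" for n
    using s(2) by (rule cong_dvd_modulus) simp
  then have "s n mod p ^ n \<in> {0..<p ^ n} \<and> (s (Suc n) mod p ^ Suc n) mod p ^ n = s n mod p ^ n" for n
    unfolding p_def by (intro padic_seq_lift) (simp add: Cong.cong_def)
  then have z: "Rep_padic_int z n = s n mod p ^ n" for n
    unfolding z_def p_def by (subst Abs_padic_int_inverse) auto
  have "Rep_padic_int (poly (of_int_poly f) z) n = 0" for n
  proof -
    have "p ^ n dvd poly f (s n)"
      using s(1)[of n] by (metis dvd_mult_left power_Suc mult.commute)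
    moreover have "[poly f (s n mod p ^ n) = poly f (s n)] (mod p ^ n)"
      by (rule cong_poly) simp
    ultimately show ?thesis
      unfolding Rep_padic_int_poly z by (simp add: Cong.cong_def p_def mod_0_imp_dvd)
  qed
  then have "Rep_padic_int (poly (of_int_poly f) z) = Rep_padic_int (0 :: 'p padic_int)"
    by (auto simp: zero_padic_int.rep_eq)
  then have "poly (of_int_poly f) z = 0"
    by (simp only: Rep_padic_int_inject)
  then show ?thesis ..
qed

section \<open>Cardano's formula over the p-adic numbers\<close>

lemma prime_dvd_square_add_3_square:
  assumes "odd CARD('p::prime_card)" "[CARD('p) = 2] (mod 3)" "int CARD('p) dvd a\<^sup>2 + 3 * b\<^sup>2"
  shows "int CARD('p) dvd a \<and> int CARD('p) dvd b"
proof -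
  have "(of_int (a\<^sup>2 + 3 * b\<^sup>2) :: 'p mod_ring) = 0"
    using assms(3) by (simp only: of_int_mod_ring_eq_0_iff)
  then have "(of_int a :: 'p mod_ring)\<^sup>2 + 3 * (of_int b)\<^sup>2 = 0" by simp
  from square_add_3_square_eq_0_mod_ring[OF assms(1,2) this]
  show ?thesis by (simp only: of_int_mod_ring_eq_0_iff)
qed

text \<open>Descent: the prime divides both \<open>a\<close> and \<open>b\<close>, and cancelling
  its square leaves the same form with \<open>n\<close> lowered by one.\<close>

lemma prime_power_dvd_square_add_3_square:
  assumes "odd CARD('p::prime_card)" "[CARD('p) = 2] (mod 3)" "int CARD('p) ^ (2 * n) dvd a\<^sup>2 + 3 * b\<^sup>2"
  shows "int CARD('p) ^ n dvd a \<and> int CARD('p) ^ n dvd b"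
  using assms(3)
proof (induction n arbitrary: a b)
  case (Suc n)
  let ?p = "int CARD('p)"
  have "?p dvd ?p ^ (2 * Suc n)" by simp
  then have "?p dvd a\<^sup>2 + 3 * b\<^sup>2" using Suc.prems by (rule dvd_trans)
  then obtain a' b' where ab: "a = ?p * a'" "b = ?p * b'"
    using prime_dvd_square_add_3_square[OF assms(1,2)] by blast
  have "?p\<^sup>2 * ?p ^ (2 * n) dvd ?p\<^sup>2 * (a'\<^sup>2 + 3 * b'\<^sup>2)"
  proof -
    have "?p\<^sup>2 * (a'\<^sup>2 + 3 * b'\<^sup>2) = a\<^sup>2 + 3 * b\<^sup>2"
      unfolding ab by (simp add: algebra_simps power2_eq_square)
    moreover have "?p\<^sup>2 * ?p ^ (2 * n) = ?p ^ (2 * Suc n)"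
      by (simp flip: power_add)
    ultimately show ?thesis using Suc.prems by (simp only:)
  qed
  then have "?p ^ (2 * n) dvd a'\<^sup>2 + 3 * b'\<^sup>2"
    by (subst (asm) dvd_mult_cancel_left) simp
  then have "?p ^ n dvd a' \<and> ?p ^ n dvd b'" by (rule Suc.IH)
  then show ?case unfolding ab by simp
qed simp

lemma square_add_3_square_eq_0_padic_int:
  fixes a b :: "'p::prime_card padic_int"
  assumes "odd CARD('p)" "[CARD('p) = 2] (mod 3)" "a\<^sup>2 + 3 * b\<^sup>2 = 0"
  shows "b = 0"
proof -
  let ?p = "int CARD('p)" let ?b = "Rep_padic_int b"
  have "?b n = 0" for n
  proof -
    \<comment> \<open>Twice the precision is taken because divisibility of the form by the power
      \<open>2 * n\<close> yields only the power \<open>n\<close> for \<open>b\<close>.\<close>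
    define N where "N = 2 * n"
    have "Rep_padic_int (a * a + of_int 3 * (b * b)) N = 0"
      using assms(3) by (simp add: power2_eq_square zero_padic_int.rep_eq)
    moreover have "(x * x mod q + (3 mod q) * (y * y mod q) mod q) mod q = (x\<^sup>2 + 3 * y\<^sup>2) mod q" for x y q :: int
      by (simp add: mod_simps power2_eq_square)
    ultimately have "((Rep_padic_int a N)\<^sup>2 + 3 * (?b N)\<^sup>2) mod ?p ^ N = 0"
      unfolding plus_padic_int.rep_eq times_padic_int.rep_eq Rep_padic_int_of_int
      by (simp only:)
    then have "?p ^ n dvd ?b N"
      unfolding N_def dvd_eq_mod_eq_0[symmetric]
      using prime_power_dvd_square_add_3_square[OF assms(1,2)] by blast
    moreover have "?b (n + n) mod ?p ^ n = ?b n"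
      by (rule padic_int_mod[of ?b "CARD('p)"]) (rule Rep_padic_int[unfolded mem_Collect_eq])
    ultimately show ?thesis unfolding N_def mult_2 by (simp only: dvd_eq_mod_eq_0)
  qed
  then have "?b = Rep_padic_int (0 :: 'p padic_int)"
    by (auto simp: zero_padic_int.rep_eq)
  then show ?thesis by (simp only: Rep_padic_int_inject)
qed

text \<open>Clearing denominators gives \<open>a\<^sup>2 + 3 * b\<^sup>2 = 0\<close> in the p-adic
  integers, which forces \<open>b = 0\<close>. So adjoining a square root of -3 is a proper
  quadratic extension.\<close>

lemma square_neq_minus_3_padic:
  fixes x :: "'p::prime_card padic"
  assumes "odd CARD('p)" "[CARD('p) = 2] (mod 3)"
  shows "x\<^sup>2 \<noteq> -3"
proof
  assume x: "x\<^sup>2 = -3"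
  obtain a b where ab: "x = Fract a b" "b \<noteq> 0" by (cases x) auto
  have "x\<^sup>2 * to_fract (b * b) = to_fract (a * a)"
    using ab by (simp add: power2_eq_square to_fract_def eq_fract)
  then have eq: "to_fract (a * a) = - 3 * to_fract (b * b)"
    unfolding x by (rule sym)
  have "to_fract (a * a + (b * b + b * b + b * b)) = 0"
    unfolding to_fract_add eq by simp
  then have "a\<^sup>2 + 3 * b\<^sup>2 = 0"
    by (simp only: to_fract_eq_0_iff) (simp add: power2_eq_square)
  then show False using square_add_3_square_eq_0_padic_int[OF assms] ab(2) by blast
qed

lemma to_ac_of_rat: "to_ac (of_rat r) = of_rat r"
  by (cases r) (simp add: of_rat_rat)

text \<open>Otherwise \<open>s\<close> would come from the ground field. This independence allows
  coordinates in the basis 1, \<open>s\<close> to be compared.\<close>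

lemma to_ac_add_sqrt_eq_0:
  fixes s :: "'a::field alg_closure"
  assumes "\<And>x :: 'a. x\<^sup>2 \<noteq> -3" "s\<^sup>2 = -3" "to_ac a + to_ac b * s = 0"
  shows "a = 0 \<and> b = 0"
proof (cases "b = 0")
  case False
  then have "s = to_ac (- a / b)"
    using assms(3) by (simp add: field_simps eq_neg_iff_add_eq_0)
  then have "to_ac ((- a / b)\<^sup>2) = to_ac (- 3)"
    using assms(2) by (simp only: to_ac_power to_ac_minus to_ac_numeral)
  then show ?thesis using assms(1) by (metis to_ac_eq_iff)
qed (use assms in simp)

lemma to_ac_add_sqrt_eq_iff:
  fixes s :: "'a::field alg_closure"
  assumes "\<And>x :: 'a. x\<^sup>2 \<noteq> -3" "s\<^sup>2 = -3"
  shows "to_ac a + to_ac b * s = to_ac a' + to_ac b' * s \<longleftrightarrow> a = a' \<and> b = b'"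
  using to_ac_add_sqrt_eq_0[OF assms, of "a - a'" "b - b'"] by (auto simp: algebra_simps)

text \<open>The only other square root is \<open>- s\<close>, and the sign can be moved into
  \<open>b\<close>; so one fixed \<open>s\<close> describes the whole field.\<close>

lemma Qp_sqrt_m3_eq:
  fixes s :: "'p::prime_card padic alg_closure"
  assumes "s\<^sup>2 = -3"
  shows "Qp_sqrt_m3 = {to_ac a + to_ac b * s |a b. True}"
proof -
  have "to_ac a + to_ac b * s' \<in> {to_ac a + to_ac b * s |a b. True}" if "s'\<^sup>2 = -3"
    for a b and s' :: "'p padic alg_closure"
  proof -
    have "s' = s \<or> s' = - s" using that assms by (simp flip: power2_eq_iff)
    then show ?thesis
    proof
      assume "s' = - s"
      then have "to_ac a + to_ac b * s' = to_ac a + to_ac (- b) * s" by simp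
      then show ?thesis by blast
    qed blast
  qed
  then show ?thesis using assms by (fastforce simp: Qp_sqrt_m3_def)
qed

text \<open>The tests of one round in a single predicate, so that a run of the algorithm becomes a
  search for the first accepted polynomial.\<close>

definition accepts :: "(int poly \<Rightarrow> 'p::prime_card padic alg_closure) \<Rightarrow> int poly \<Rightarrow> bool" where
  "accepts rt f \<longleftrightarrow>
    (let \<Delta> = of_rat (Delta f) :: 'p padic alg_closure; B = of_rat (depressed_B f);
         C = (if depressed_A f = 0 then - B else rt f); x = (- B + C) / 2
     in \<not> is_square_in Qp \<Delta> \<and> is_square_in Qp_sqrt_m3 \<Delta> \<and>
        is_cube_in Qp_sqrt_m3 x \<and> \<not> is_cube_in Qp x)"

lemma algorithm_eq_find:
  "algorithm rt fs = map_option (\<lambda>f. 1 / 3 * ln (mahler_measure f)) (find (accepts rt) fs)"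
  by (induction fs) (auto simp: accepts_def Let_def)

text \<open>
  If \<open>u = m + n * s\<close> is a cube root of \<open>(- B + C) / 2\<close>, then \<open>A = - 3 * (m\<^sup>2 + 3 * n\<^sup>2)\<close>, since both
  sides have the same cube. So the depressed cubic has the roots \<open>2 * m\<close> and
  \<open>- m \<plusminus> 3 * n\<close>.
\<close>

lemma cube_parametrization:
  fixes s C u :: "'p::prime_card padic alg_closure"
  assumes nsq: "\<And>x :: 'p padic. x\<^sup>2 \<noteq> -3" and s: "s\<^sup>2 = -3"
    and \<Delta>: "C\<^sup>2 = to_ac (B\<^sup>2 + 4 * A ^ 3 / 27)" "\<not> is_square_in Qp (to_ac (B\<^sup>2 + 4 * A ^ 3 / 27))"
    and C: "C \<in> Qp_sqrt_m3" and u: "u \<in> Qp_sqrt_m3" "u ^ 3 = (- to_ac B + C) / 2"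
  shows "\<exists>m n. A = - 3 * (m\<^sup>2 + 3 * n\<^sup>2) \<and> B = - 2 * m * (m\<^sup>2 - 9 * n\<^sup>2)"
proof -
  obtain c0 c where c: "C = to_ac c0 + to_ac c * s" using C unfolding Qp_sqrt_m3_eq[OF s] by blast
  obtain m n where mn: "u = to_ac m + to_ac n * s" using u(1) unfolding Qp_sqrt_m3_eq[OF s] by blast
  have ss: "s * s = - 3" using s by (simp add: power2_eq_square)
  have sss: "s * (s * x) = - 3 * x" for x by (simp only: ss mult.assoc[symmetric])
  have "to_ac (c0\<^sup>2 - 3 * c\<^sup>2) + to_ac (2 * c0 * c) * s = C\<^sup>2"
    unfolding c by (simp add: power2_eq_square algebra_simps ss sss)
  also have "\<dots> = to_ac (B\<^sup>2 + 4 * A ^ 3 / 27) + to_ac 0 * s" using \<Delta>(1) by simp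
  finally have "c0\<^sup>2 - 3 * c\<^sup>2 = B\<^sup>2 + 4 * A ^ 3 / 27" "2 * c0 * c = 0"
    unfolding to_ac_add_sqrt_eq_iff[OF nsq s] by blast+
  \<comment> \<open>The square of \<open>C\<close> lies in the ground field but \<open>C\<close>
    does not, so \<open>C\<close> is a pure multiple of \<open>s\<close>.\<close>
  moreover have "c \<noteq> 0"
  proof
    assume "c = 0"
    then have "C = to_ac c0" using c by simp
    then show False using \<Delta> by (auto simp: is_square_in_def Qp_def)
  qed
  ultimately have c0: "c0 = 0" and \<Delta>c: "- 3 * c\<^sup>2 = B\<^sup>2 + 4 * A ^ 3 / 27" by auto
  have "to_ac (2 * (m ^ 3 - 9 * m * n\<^sup>2)) + to_ac (2 * (3 * m\<^sup>2 * n - 3 * n ^ 3)) * s = 2 * u ^ 3"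
    unfolding mn by (simp add: power2_eq_square power3_eq_cube algebra_simps ss sss)
  also have "\<dots> = to_ac (- B) + to_ac c * s"
    unfolding u(2) c c0 by simp
  finally have eqs: "2 * (m ^ 3 - 9 * m * n\<^sup>2) = - B" "2 * (3 * m\<^sup>2 * n - 3 * n ^ 3) = c"
    unfolding to_ac_add_sqrt_eq_iff[OF nsq s] by blast+
  define N where "N = - 3 * (m\<^sup>2 + 3 * n\<^sup>2)"
  have "4 * A ^ 3 = 27 * (- 3 * c\<^sup>2 - (- B)\<^sup>2)" unfolding \<Delta>c by simp
  also have "\<dots> = 4 * N ^ 3"
    unfolding N_def eqs[symmetric] by (simp add: power2_eq_square power3_eq_cube algebra_simps)
  finally have AN: "A ^ 3 = N ^ 3" by simp
  have "A = N"
  proof (cases "N = 0")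
    case False
    have "(A - N) * (A\<^sup>2 + A * N + N\<^sup>2) = A ^ 3 - N ^ 3"
      by (simp add: power2_eq_square power3_eq_cube algebra_simps)
    then have "A = N \<or> A\<^sup>2 + A * N + N\<^sup>2 = 0" using AN by simp
    \<comment> \<open>Equal cubes have equal bases here: otherwise \<open>(2 * A + N) / N\<close>
      would be a square root of -3.\<close>
    moreover have "A\<^sup>2 + A * N + N\<^sup>2 \<noteq> 0"
    proof
      assume 0: "A\<^sup>2 + A * N + N\<^sup>2 = 0"
      have "(2 * A + N)\<^sup>2 + 3 * N\<^sup>2 = 4 * (A\<^sup>2 + A * N + N\<^sup>2)"
        by (simp add: power2_eq_square algebra_simps)
      then have "(2 * A + N)\<^sup>2 = - 3 * N\<^sup>2" using 0 by (simp add: eq_neg_iff_add_eq_0)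
      then have "((2 * A + N) / N)\<^sup>2 = -3" using False by (simp add: power_divide)
      then show False using nsq by blast
    qed
    ultimately show ?thesis by blast
  qed (use AN in simp)
  moreover have "B = - 2 * m * (m\<^sup>2 - 9 * n\<^sup>2)"
    using eqs(1) by (simp add: power2_eq_square power3_eq_cube algebra_simps)
  ultimately show ?thesis unfolding N_def by blast
qed

text \<open>Forwards, Cardano's cube root supplies \<open>m\<close> and \<open>n\<close>. Backwards,
  \<open>m + n * s\<close> or \<open>m - n * s\<close> is the required cube root, depending on the
  choice of \<open>C\<close>. The condition on \<open>m\<close> and \<open>n\<close> is the one that
  later characterises splitting.\<close>

lemma accepts_iff:
  fixes rt :: "int poly \<Rightarrow> 'p::prime_card padic alg_closure"
  assumes nsq: "\<And>x :: 'p padic. x\<^sup>2 \<noteq> -3" and rt: "sqrt_choice rt" and "Delta f \<noteq> 0"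
  shows "accepts rt f \<longleftrightarrow> (\<exists>m n :: 'p padic. of_rat (depressed_A f) = - 3 * (m\<^sup>2 + 3 * n\<^sup>2) \<and>
    of_rat (depressed_B f) = - 2 * m * (m\<^sup>2 - 9 * n\<^sup>2))"
proof -
  define A B \<Delta> :: "'p padic" where "A = of_rat (depressed_A f)" and "B = of_rat (depressed_B f)"
    and "\<Delta> = B\<^sup>2 + 4 * A ^ 3 / 27"
  have AB: "of_rat (depressed_B f) = to_ac B" "of_rat (Delta f) = to_ac \<Delta>"
    unfolding A_def B_def \<Delta>_def Delta_def by (simp_all flip: to_ac_of_rat add: of_rat_add of_rat_mult of_rat_divide of_rat_power)
  have A0: "depressed_A f = 0 \<longleftrightarrow> A = 0" by (simp add: A_def)
  have \<Delta>0: "\<Delta> \<noteq> 0" using assms(3) AB(2) by auto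
  \<comment> \<open>For \<open>A = 0\<close> the value \<Delta> is the square of \<open>B\<close>.
    Hence acceptance forces \<open>A\<close> to be nonzero and \<open>C = rt f\<close>.\<close>
  have sqB: "is_square_in Qp (to_ac \<Delta>)" if "A = 0"
    using that by (auto simp: is_square_in_def Qp_def \<Delta>_def intro!: exI[of _ B])
  have rtC: "rt f \<in> Qp_sqrt_m3" "(rt f)\<^sup>2 = to_ac \<Delta>" if "is_square_in Qp_sqrt_m3 (to_ac \<Delta>)"
    using rt that unfolding sqrt_choice_def AB(2)[symmetric] by blast+
  obtain s :: "'p padic alg_closure" where s: "s\<^sup>2 = -3"
    using nth_root_exists[of 2 "-3"] by auto
  have ss: "s * s = - 3" using s by (simp add: power2_eq_square)
  have sss: "s * (s * x) = - 3 * x" for x by (simp only: ss mult.assoc[symmetric])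
  have "accepts rt f" if mn: "A = - 3 * (m\<^sup>2 + 3 * n\<^sup>2)" "B = - 2 * m * (m\<^sup>2 - 9 * n\<^sup>2)" for m n
  proof -
    \<comment> \<open>Twice the coefficient of \<open>s\<close> in \<open>(m + n * s) ^ 3\<close>,
      hence the coefficient of \<open>s\<close> in one of the two possible values of
      \<open>C\<close>.\<close>
    define c where "c = 6 * n * (m\<^sup>2 - n\<^sup>2)"
    have \<Delta>c: "\<Delta> = - 3 * c\<^sup>2"
      unfolding \<Delta>_def mn c_def by (simp add: power2_eq_square power3_eq_cube field_simps)
    then have c0: "c \<noteq> 0" using \<Delta>0 by auto
    have notsq: "\<not> is_square_in Qp (to_ac \<Delta>)"
    proof
      assume "is_square_in Qp (to_ac \<Delta>)"
      then obtain y where "to_ac (y\<^sup>2) = to_ac \<Delta>" by (auto simp: is_square_in_def Qp_def)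
      then have "(y / c)\<^sup>2 = -3" using c0 by (simp only: to_ac_eq_iff) (simp add: \<Delta>c power_divide)
      then show False using nsq by blast
    qed
    have sq: "(to_ac c * s)\<^sup>2 = to_ac \<Delta>" unfolding \<Delta>c by (simp add: power_mult_distrib s)
    have "to_ac c * s = to_ac 0 + to_ac c * s" by simp
    then have sqK: "is_square_in Qp_sqrt_m3 (to_ac \<Delta>)"
      using sq unfolding is_square_in_def Qp_sqrt_m3_eq[OF s] by blast
    have "(rt f)\<^sup>2 = (to_ac c * s)\<^sup>2" using rtC(2)[OF sqK] sq by simp
    then consider "rt f = to_ac c * s" | "rt f = - (to_ac c * s)" by (auto simp: power2_eq_iff)
    \<comment> \<open>The sign \<open>e\<close> records which square root \<open>rt\<close> has
      chosen; \<open>n\<close> is replaced by \<open>e * n\<close> accordingly.\<close>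
    then obtain e :: "'p padic" where e: "e = 1 \<or> e = -1" "rt f = to_ac (e * c) * s"
      by cases (metis mult_1, metis mult_minus1 minus_mult_left to_ac_minus)
    have "(to_ac m + to_ac (e * n) * s) ^ 3 =
        to_ac (m ^ 3 - 9 * m * (e * n)\<^sup>2) + to_ac (3 * m\<^sup>2 * (e * n) - 3 * (e * n) ^ 3) * s"
      by (simp add: power2_eq_square power3_eq_cube algebra_simps ss sss)
    also have "\<dots> = (- to_ac B + rt f) / 2"
      using e(1) unfolding e(2) mn c_def by (auto simp: field_simps power2_eq_square power3_eq_cube)
    finally have "is_cube_in Qp_sqrt_m3 ((- to_ac B + rt f) / 2)"
      unfolding is_cube_in_def Qp_sqrt_m3_eq[OF s] by blast
    moreover have "\<not> is_cube_in Qp ((- to_ac B + rt f) / 2)"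
    proof
      assume "is_cube_in Qp ((- to_ac B + rt f) / 2)"
      then obtain y where "to_ac (y ^ 3) = (- to_ac B + rt f) / 2" by (auto simp: is_cube_in_def Qp_def)
      then have "rt f = to_ac (2 * y ^ 3 + B)" by (simp add: field_simps)
      then show False using rtC(2)[OF sqK] notsq unfolding is_square_in_def Qp_def by blast
    qed
    ultimately show ?thesis
      using notsq sqK sqB unfolding accepts_def Let_def AB A0 by auto
  qed
  moreover have "\<exists>m n. A = - 3 * (m\<^sup>2 + 3 * n\<^sup>2) \<and> B = - 2 * m * (m\<^sup>2 - 9 * n\<^sup>2)" if acc: "accepts rt f"
  proof -
    have notsq: "\<not> is_square_in Qp (to_ac \<Delta>)" and sqK: "is_square_in Qp_sqrt_m3 (to_ac \<Delta>)"
      using acc unfolding accepts_def Let_def AB by blast+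
    then have "A \<noteq> 0" using sqB by blast
    then obtain u where "u \<in> Qp_sqrt_m3" "u ^ 3 = (- to_ac B + rt f) / 2"
      using acc unfolding accepts_def Let_def AB A0 is_cube_in_def by auto
    then show ?thesis
      using cube_parametrization[OF nsq s _ _ rtC(1)] rtC(2)[OF sqK] sqK notsq unfolding \<Delta>_def by blast
  qed
  ultimately show ?thesis unfolding A_def[symmetric] B_def[symmetric] by blast
qed

lemma cubic_eq_coeffs:
  assumes "degree f = 3"
  shows "f = [:coeff f 0, coeff f 1, coeff f 2, coeff f 3:]"
proof (rule Polynomial.poly_eqI)
  fix i :: nat
  consider "i = 0" | "i = 1" | "i = 2" | "i = 3" | "i > 3" by linarith
  then show "coeff f i = coeff [:coeff f 0, coeff f 1, coeff f 2, coeff f 3:] i"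
  proof cases
    case 5
    then have "coeff f i = 0" using assms by (simp add: coeff_eq_0)
    moreover obtain k where "i = Suc (Suc (Suc (Suc k)))"
      using 5 by (auto dest!: less_imp_Suc_add simp: numeral_3_eq_3)
    ultimately show ?thesis by simp
  qed (simp_all add: numeral_2_eq_2 numeral_3_eq_3)
qed

text \<open>With \<open>e = b / (3 * a)\<close> the coefficients are those of
  \<open>a * g (x + e)\<close>, where \<open>g\<close> is the depressed cubic. The general field
  serves both the rational and the p-adic numbers.\<close>

lemma cubic_eq_shifted_depressed:
  fixes f :: "int poly"
  assumes "degree f = 3"
  obtains a e :: "'a::field_char_0" where "a \<noteq> 0"
    "of_int_poly f = [:a * (of_rat (depressed_B f) + of_rat (depressed_A f) * e + e ^ 3),
       a * (of_rat (depressed_A f) + 3 * e\<^sup>2), 3 * a * e, a:]"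
proof -
  define a b c d :: 'a where "a = of_int (coeff f 3)" and "b = of_int (coeff f 2)"
    and "c = of_int (coeff f 1)" and "d = of_int (coeff f 0)"
  define A B :: 'a where "A = of_rat (depressed_A f)" and "B = of_rat (depressed_B f)"
  define e where "e = b / (3 * a)"
  have "f \<noteq> 0" using assms by auto
  then have "coeff f (degree f) \<noteq> 0" by (simp only: leading_coeff_0_iff not_False_eq_True)
  then have a0: "a \<noteq> 0" unfolding a_def assms by simp
  have A: "A = (3 * a * c - b\<^sup>2) / (3 * a\<^sup>2)"
    and B: "B = (27 * a\<^sup>2 * d - 9 * a * b * c + 2 * b ^ 3) / (27 * a ^ 3)"
    unfolding A_def B_def a_def b_def c_def d_def depressed_A_def depressed_B_def Let_def
    by (simp_all add: of_rat_add of_rat_mult of_rat_divide of_rat_power of_rat_diff)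
  have be: "b = 3 * a * e" using a0 by (simp add: e_def)
  have "3 * a\<^sup>2 \<noteq> 0" using a0 by simp
  then have "3 * a\<^sup>2 * A = 3 * a * c - b\<^sup>2" unfolding A by (metis times_divide_eq_right nonzero_mult_div_cancel_left)
  then have "3 * a * (a * A) = 3 * a * (c - 3 * a * e\<^sup>2)"
    unfolding be by (simp add: power2_eq_square algebra_simps)
  then have aA: "a * A = c - 3 * a * e\<^sup>2" using a0 by simp
  have "27 * a ^ 3 \<noteq> 0" using a0 by simp
  then have "27 * a ^ 3 * B = 27 * a\<^sup>2 * d - 9 * a * b * c + 2 * b ^ 3"
    unfolding B by (metis times_divide_eq_right nonzero_mult_div_cancel_left)
  then have "27 * a\<^sup>2 * (a * B) = 27 * a\<^sup>2 * (d - c * e + 2 * a * e ^ 3)"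
    unfolding be by (simp add: power2_eq_square power3_eq_cube algebra_simps)
  then have aB: "a * B = d - c * e + 2 * a * e ^ 3" using a0 by simp
  have Ae: "c = a * (A + 3 * e\<^sup>2)" using aA by (simp add: algebra_simps)
  have "a * (B + A * e + e ^ 3) = a * B + (a * A) * e + a * e ^ 3" by (simp add: algebra_simps)
  also have "\<dots> = d" unfolding aA aB by (simp add: power2_eq_square power3_eq_cube algebra_simps)
  finally have Be: "d = a * (B + A * e + e ^ 3)" by simp
  have "of_int_poly f = [:d, c, b, a:]"
    by (subst cubic_eq_coeffs[OF assms]) (simp add: hom_distribs a_def b_def c_def d_def)
  then show ?thesis using that[of a e] a0 unfolding Ae Be be A_def B_def by blast
qed

text \<open>The roots of the depressed cubic have sum 0, so they can be written as
  \<open>2 * m\<close>, \<open>- m + 3 * n\<close>, \<open>- m - 3 * n\<close>; the two equations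
  are Vieta's formulas for them.\<close>

lemma splits_completely_iff_depressed:
  fixes f :: "int poly"
  assumes "degree f = 3"
  shows "splits_completely (of_int_poly f :: 'a::field_char_0 poly) \<longleftrightarrow>
    (\<exists>m n :: 'a. of_rat (depressed_A f) = - 3 * (m\<^sup>2 + 3 * n\<^sup>2) \<and>
      of_rat (depressed_B f) = - 2 * m * (m\<^sup>2 - 9 * n\<^sup>2))"
proof -
  define A B :: 'a where "A = of_rat (depressed_A f)" and "B = of_rat (depressed_B f)"
  obtain a e :: 'a where a0: "a \<noteq> 0"
    and f: "of_int_poly f = [:a * (B + A * e + e ^ 3), a * (A + 3 * e\<^sup>2), 3 * a * e, a:]"
    using cubic_eq_shifted_depressed[OF assms] unfolding A_def B_def by blast
  show ?thesis unfolding A_def[symmetric] B_def[symmetric]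
  proof
    assume "splits_completely (of_int_poly f :: 'a poly)"
    then obtain a' rs where rs: "[:a * (B + A * e + e ^ 3), a * (A + 3 * e\<^sup>2), 3 * a * e, a:] = smult a' (\<Prod>r\<leftarrow>rs. [:- r, 1:])"
      unfolding f splits_completely_def by blast
    then have a': "a' \<noteq> 0" using a0 by auto
    have "length rs = degree [:a * (B + A * e + e ^ 3), a * (A + 3 * e\<^sup>2), 3 * a * e, a:]"
      unfolding rs using a' degree_linear_factors[of uminus rs] by simp
    then have "length rs = 3" using a0 by simp
    then obtain x y z where xyz: "rs = [x, y, z]"
      by (auto simp: numeral_3_eq_3 length_Suc_conv)
    have coeffs: "a = a'" "3 * a * e = - a' * (x + y + z)"
      "a * (A + 3 * e\<^sup>2) = a' * (x * y + x * z + y * z)"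
      "a * (B + A * e + e ^ 3) = - a' * x * y * z"
    proof -
      have "smult a' (\<Prod>r\<leftarrow>rs. [:- r, 1:]) =
          [:- a' * x * y * z, a' * (x * y + x * z + y * z), - a' * (x + y + z), a':]"
        unfolding xyz by (simp add: algebra_simps)
      then show "a = a'" "3 * a * e = - a' * (x + y + z)"
        "a * (A + 3 * e\<^sup>2) = a' * (x * y + x * z + y * z)"
        "a * (B + A * e + e ^ 3) = - a' * x * y * z"
        unfolding rs[symmetric] pCons_eq_iff by blast+
    qed
    note eqs = coeffs(2-4)[unfolded coeffs(1)]
    \<comment> \<open>The shift by \<open>e\<close> carries roots of \<open>f\<close> to roots of
      the depressed cubic: \<open>2 * m\<close> is the first of them and \<open>6 * n\<close> the
      difference of the other two.\<close>
    define m n where "m = (x + e) / 2" and "n = (y - z) / 6"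
    have "a' * (3 * e) = a' * (- (x + y + z))" using eqs(1) by (simp add: algebra_simps)
    then have "3 * e = - (x + y + z)" using a' mult_left_cancel by blast
    then have e: "e = - (x + y + z) / 3" by (simp add: eq_divide_eq mult.commute)
    have xyz: "x = 2 * m - e" "y = - m + 3 * n - e" "z = - m - 3 * n - e"
      by (simp_all add: m_def n_def e field_simps)
    have "a' * (A + 3 * e\<^sup>2) = a' * (x * y + x * z + y * z)"
      by (rule eqs(2))
    then have "A = x * y + x * z + y * z - 3 * e\<^sup>2"
      using a' by (simp add: eq_diff_eq)
    then have A_mn: "A = - 3 * (m\<^sup>2 + 3 * n\<^sup>2)"
      unfolding xyz by (simp add: power2_eq_square algebra_simps)
    moreover have "a' * (B + A * e + e ^ 3) = a' * (- x * y * z)"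
      using eqs(3) by (simp add: mult.assoc)
    then have "B + A * e + e ^ 3 = - x * y * z"
      using a' mult_left_cancel by blast
    then have "B = - x * y * z - A * e - e ^ 3"
      by (simp add: algebra_simps)
    then have "B = - 2 * m * (m\<^sup>2 - 9 * n\<^sup>2)"
      unfolding xyz A_mn by (simp add: power2_eq_square power3_eq_cube algebra_simps)
    ultimately show "\<exists>m n. A = - 3 * (m\<^sup>2 + 3 * n\<^sup>2) \<and> B = - 2 * m * (m\<^sup>2 - 9 * n\<^sup>2)" by blast
  next
    assume "\<exists>m n. A = - 3 * (m\<^sup>2 + 3 * n\<^sup>2) \<and> B = - 2 * m * (m\<^sup>2 - 9 * n\<^sup>2)"
    then obtain m n where mn: "A = - 3 * (m\<^sup>2 + 3 * n\<^sup>2)" "B = - 2 * m * (m\<^sup>2 - 9 * n\<^sup>2)" by blast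
    have "[:a * (B + A * e + e ^ 3), a * (A + 3 * e\<^sup>2), 3 * a * e, a:] = smult a (\<Prod>r\<leftarrow>[2 * m - e, - m + 3 * n - e, - m - 3 * n - e]. [:- r, 1:])"
      unfolding mn by (simp add: algebra_simps power2_eq_square power3_eq_cube)
    then show "splits_completely (of_int_poly f :: 'a poly)"
      unfolding f splits_completely_def by blast
  qed
qed

section \<open>Irreducible integer polynomials and heights\<close>

text \<open>Gauss's lemma: a rational factorisation yields an integral one with the same
  degrees.\<close>

lemma irreducible_int_poly_rat_factor:
  fixes f :: "int poly"
  assumes "irreducible f" "of_int_poly f = g * (h :: rat poly)"
  shows "degree g = 0 \<or> degree h = 0"
proof -
  obtain g' h' where gh: "f = g' * h'" "degree g' = degree g" "degree h' = degree h"
    using rat_to_int_factor[OF assms(2)] by blast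
  have "g' dvd 1 \<or> h' dvd 1"
    using Factorial_Ring.irreducibleD[OF assms(1) gh(1)] .
  then show ?thesis using gh(2,3) unfolding poly_dvd_1 by auto
qed

lemma irreducible_int_poly_no_rat_root:
  fixes f :: "int poly"
  assumes "irreducible f" "degree f \<ge> 2"
  shows "poly (of_int_poly f) (x :: rat) \<noteq> 0"
proof
  assume "poly (of_int_poly f) x = 0"
  then obtain h where h: "of_int_poly f = [:- x, 1:] * h" by (auto simp: poly_eq_0_iff_dvd)
  then have "degree h = 0"
    using irreducible_int_poly_rat_factor[OF assms(1) h] by simp
  moreover have "degree f = 1 + degree h"
  proof -
    have "h \<noteq> 0" using h assms(2) by auto
    then show ?thesis
      using arg_cong[OF h, of degree] by (subst (asm) degree_mult_eq) auto
  qed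
  ultimately show False using assms(2) by simp
qed

lemma of_rat_poly_of_int_poly:
  "map_poly (of_rat :: rat \<Rightarrow> 'a::field_char_0) (of_int_poly f) = of_int_poly f"
  by (simp add: map_poly_map_poly o_def)

text \<open>A rational polynomial \<open>m\<close> of least degree vanishing at \<alpha> divides
  every other one, by division with remainder. Irreducibility makes \<open>f\<close> a constant
  multiple of \<open>m\<close>.\<close>

lemma irreducible_int_poly_dvd:
  fixes f g :: "int poly" and \<alpha> :: "'a::field_char_0"
  assumes "irreducible f" "poly (of_int_poly f) \<alpha> = 0" "poly (of_int_poly g) \<alpha> = 0"
  shows "(of_int_poly f :: rat poly) dvd of_int_poly g"
proof -
  interpret hom: map_poly_idom_hom "of_rat :: rat \<Rightarrow> 'a" ..
  define V where "V p \<longleftrightarrow> p \<noteq> 0 \<and> poly (map_poly of_rat p) \<alpha> = 0" for p :: "rat poly"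
  have f: "V (of_int_poly f)" using assms(1,2) by (auto simp: V_def of_rat_poly_of_int_poly)
  then obtain m where m: "V m" "\<And>q. V q \<Longrightarrow> degree m \<le> degree q"
    using ex_has_least_nat[of V _ degree] by blast
  have m_dvd: "m dvd q" if "poly (map_poly of_rat q) \<alpha> = 0" for q
  proof (rule ccontr)
    assume "\<not> m dvd q"
    then have "q mod m \<noteq> 0" by (simp add: mod_eq_0_iff_dvd)
    moreover have "q mod m = q - m * (q div m)" by (simp add: minus_mult_div_eq_mod)
    then have "poly (map_poly of_rat (q mod m)) \<alpha> = 0"
      using that m(1) by (simp only: V_def hom.hom_minus hom.hom_mult) simp
    ultimately have "degree m \<le> degree (q mod m)" using m(2) by (simp add: V_def)
    moreover have "m \<noteq> 0" using m(1) by (simp add: V_def)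
    ultimately show False
      using degree_mod_less[of m q] \<open>q mod m \<noteq> 0\<close> by simp
  qed
  obtain h where h: "of_int_poly f = m * h"
    using m_dvd[of "of_int_poly f"] f by (auto simp: V_def elim: dvdE)
  have "degree m \<noteq> 0"
  proof
    assume "degree m = 0"
    then obtain c where "m = [:c:]" by (rule degree_eq_zeroE)
    then show False using m(1) by (simp add: V_def hom_distribs)
  qed
  then have "degree h = 0" using irreducible_int_poly_rat_factor[OF assms(1) h] by simp
  then obtain c where c: "h = [:c:]" by (rule degree_eq_zeroE)
  then have "c \<noteq> 0" using h f by (auto simp: V_def)
  moreover have "of_int_poly f = smult c m" using h c by simp
  moreover have "m dvd of_int_poly g" using m_dvd assms(3) by (simp add: of_rat_poly_of_int_poly)
  ultimately show ?thesis by (simp add: smult_dvd)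
qed

lemma irreducible_int_poly_root_transfer:
  fixes f g :: "int poly" and \<alpha> \<beta> :: "'a::field_char_0"
  assumes "irreducible f" "poly (of_int_poly f) \<alpha> = 0" "poly (of_int_poly g) \<alpha> = 0"
    "poly (of_int_poly f) \<beta> = 0"
  shows "poly (of_int_poly g) \<beta> = 0"
proof -
  interpret hom: map_poly_idom_hom "of_rat :: rat \<Rightarrow> 'a" ..
  obtain h :: "rat poly" where "of_int_poly g = of_int_poly f * h"
    using irreducible_int_poly_dvd[OF assms(1-3)] by (rule dvdE)
  then have "map_poly of_rat (of_int_poly g) = map_poly of_rat (of_int_poly f) * (map_poly of_rat h :: 'a poly)"
    by (simp only: hom.hom_mult)
  then show ?thesis using assms(4) by (simp add: of_rat_poly_of_int_poly)
qed

lemma irreducible_int_poly_degree_le: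
  fixes f g :: "int poly" and \<alpha> :: "'a::field_char_0"
  assumes "irreducible f" "poly (of_int_poly f) \<alpha> = 0" "poly (of_int_poly g) \<alpha> = 0" "g \<noteq> 0"
  shows "degree f \<le> degree g"
  using dvd_imp_degree_le[OF irreducible_int_poly_dvd[OF assms(1-3)]] assms(4) by simp

section \<open>Real roots, roots of unity and the discriminant\<close>

text \<open>In odd degree \<open>- p (- x)\<close> has the same leading coefficient as
  \<open>p\<close>, so \<open>p\<close> takes both signs far out and the intermediate value theorem
  applies.\<close>

lemma odd_degree_real_root:
  fixes p :: "real poly"
  assumes "odd (degree p)"
  shows "\<exists>x. poly p x = 0"
proof -
  have "\<exists>x. poly p x = 0" if p: "odd (degree p)" "lead_coeff p > 0" for p :: "real poly"
  proof -
    define q where "q = - pcompose p [:0, -1:]"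
    have "lead_coeff q = lead_coeff p"
      unfolding q_def lead_coeff_minus using p(1) by (subst lead_coeff_comp) auto
    then obtain b where b: "\<And>x. x \<ge> b \<Longrightarrow> poly q x > 0"
      using poly_pinfty_gt_lc[of q] p(2) by (metis less_le_trans)
    obtain a where a: "\<And>x. x \<ge> a \<Longrightarrow> poly p x > 0"
      using poly_pinfty_gt_lc[of p] p(2) by (metis less_le_trans)
    define c where "c = max 1 (max a b)"
    have "poly p c > 0" "poly q c > 0" using a b by (auto simp: c_def)
    then have "poly p (- c) < 0" by (simp add: q_def poly_pcompose)
    moreover have "- c < c" by (simp add: c_def)
    ultimately show ?thesis using poly_IVT_pos[of "- c" c p] \<open>poly p c > 0\<close> by blast
  qed
  from this[of p] this[of "- p"] show ?thesis
    using assms by (cases "lead_coeff p > 0") (auto simp: not_less le_less)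
qed

text \<open>If one root satisfies \<open>x ^ n = 1\<close>, so do all its conjugates, among them a
  real one by oddness. That one is 1 or -1, a rational root, against irreducibility.\<close>

lemma irreducible_odd_degree_not_root_of_unity:
  fixes f :: "int poly"
  assumes "irreducible f" "odd (degree f)" "degree f \<ge> 2" "poly (of_int_poly f) \<alpha> = 0"
  shows "\<not> root_of_unity \<alpha>"
proof
  assume "root_of_unity \<alpha>"
  then obtain n where n: "n > 0" "\<alpha> ^ n = 1" by (auto simp: root_of_unity_def)
  define g :: "int poly" where "g = monom 1 n - 1"
  have g: "poly (of_int_poly g) x = x ^ n - 1" for x :: complex
    by (simp add: g_def hom_distribs poly_monom)
  obtain r :: real where r: "poly (of_int_poly f) r = 0"
    using odd_degree_real_root[of "of_int_poly f"] assms(2) by auto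
  have "poly (of_int_poly f) (of_real r :: complex) = of_real (poly (of_int_poly f) r)"
    by (induction f) (simp_all add: hom_distribs)
  then have "poly (of_int_poly g) (of_real r :: complex) = 0"
    using irreducible_int_poly_root_transfer[OF assms(1,4), of g "of_real r"] n(2) r by (simp add: g)
  then have "r ^ n = 1" by (simp add: g flip: of_real_power)
  then have "\<bar>r\<bar> = 1" using power_eq_1_iff[of r n] n(1) by simp
  then have "r = of_rat 1 \<or> r = of_rat (- 1)" by auto
  then obtain q where q: "r = of_rat q" by blast
  have "poly (of_int_poly f) r = of_rat (poly (of_int_poly f) q)"
    unfolding q by (induction f) (simp_all add: hom_distribs of_rat_add of_rat_mult)
  then show False using r irreducible_int_poly_no_rat_root[OF assms(1,3), of q] by simp
qed

text \<open>If \<Delta> vanishes, the depressed cubic has a repeated root, which is rational,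
  against irreducibility.\<close>

lemma Delta_neq_0:
  assumes "irreducible f" "degree f = 3"
  shows "Delta f \<noteq> 0"
proof
  assume 0: "Delta f = 0"
  define A B where "A = depressed_A f" and "B = depressed_B f"
  obtain a e :: rat where f: "of_int_poly f = [:a * (B + A * e + e ^ 3), a * (A + 3 * e\<^sup>2), 3 * a * e, a:]"
    using cubic_eq_shifted_depressed[OF assms(2), where 'a=rat] unfolding A_def B_def of_rat_eq_id id_apply by blast
  have "B\<^sup>2 + 4 * A ^ 3 / 27 = 0" using 0 by (simp only: Delta_def A_def B_def)
  then have "27 * (B\<^sup>2 + 4 * A ^ 3 / 27) = 0" by (simp only: mult_zero_right)
  then have \<Delta>: "27 * B\<^sup>2 = - (4 * A ^ 3)" by (simp add: distrib_left add_eq_0_iff2)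
  \<comment> \<open>The double root: roots \<open>t\<close>, \<open>t\<close>,
    \<open>- 2 * t\<close> give \<open>A = - 3 * t\<^sup>2\<close> and \<open>B = 2 * t ^ 3\<close>.
    If \<open>A = 0\<close>, then \<open>B = 0\<close>, and division by zero gives the correct value
    0.\<close>
  define y where "y = - 3 * B / (2 * A)"
  have "y ^ 3 + A * y + B = 0"
  proof (cases "A = 0")
    case True
    then show ?thesis using \<Delta> by (simp add: y_def)
  next
    case False
    have y: "y * (2 * A) = - 3 * B" using False by (simp add: y_def)
    have "8 * A ^ 3 * y ^ 3 = (y * (2 * A)) ^ 3" by (simp add: power_mult_distrib)
    also have "\<dots> = - (27 * B\<^sup>2) * B" unfolding y by (simp add: power2_eq_square power3_eq_cube)
    also have "\<dots> = 4 * A ^ 3 * B" unfolding \<Delta> by simp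
    finally have "8 * A ^ 3 * (y ^ 3) = 8 * A ^ 3 * (B / 2)" by simp
    then have "y ^ 3 = B / 2" using False by simp
    moreover have "A * y = - 3 * B / 2" using False by (simp add: y_def)
    ultimately show ?thesis by simp
  qed
  moreover have "poly (of_int_poly f) (y - e) = a * (y ^ 3 + A * y + B)"
    unfolding f by (simp add: algebra_simps power2_eq_square power3_eq_cube)
  ultimately have "poly (of_int_poly f) (y - e) = 0" by simp
  then show False using irreducible_int_poly_no_rat_root[OF assms(1)] assms(2) by simp
qed

section \<open>Minimal polynomials over the integers\<close>

text \<open>Two such polynomials, each scaled by the leading coefficient of the other, have a
  difference of lower degree, which vanishes by minimality. Content and sign then fix the
  scalar.\<close>

lemma min_int_poly_eqI:
  assumes "poly (of_int_poly f) \<alpha> = 0" "f \<noteq> 0"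
    "\<And>g. g \<noteq> 0 \<Longrightarrow> poly (of_int_poly g) \<alpha> = 0 \<Longrightarrow> degree f \<le> degree g"
    "Polynomial.content f = 1" "lead_coeff f > 0"
  shows "min_int_poly \<alpha> = f"
  unfolding min_int_poly_def
proof (rule the_equality)
  show "poly (of_int_poly f) \<alpha> = 0 \<and> f \<noteq> 0 \<and>
     (\<forall>g. g \<noteq> 0 \<and> poly (of_int_poly g) \<alpha> = 0 \<longrightarrow> degree f \<le> degree g) \<and>
     Polynomial.content f = 1 \<and> lead_coeff f > 0"
    using assms by blast
next
  fix g
  assume g: "poly (of_int_poly g) \<alpha> = 0 \<and> g \<noteq> 0 \<and>
     (\<forall>h. h \<noteq> 0 \<and> poly (of_int_poly h) \<alpha> = 0 \<longrightarrow> degree g \<le> degree h) \<and>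
     Polynomial.content g = 1 \<and> lead_coeff g > 0"
  then have deg: "degree g = degree f" using assms(1-3) by (meson le_antisym)
  define h where "h = smult (lead_coeff f) g - smult (lead_coeff g) f"
  have "h = 0"
  proof (rule ccontr)
    assume "h \<noteq> 0"
    moreover have "poly (of_int_poly h) \<alpha> = 0" using assms(1) g by (simp add: h_def hom_distribs)
    ultimately have "degree f \<le> degree h" using assms(3) by blast
    moreover have "degree h \<le> degree f"
      unfolding h_def using deg by (intro degree_diff_le) auto
    moreover have "coeff h (degree f) = 0" using deg by (simp add: h_def)
    ultimately show False using \<open>h \<noteq> 0\<close> by (metis le_antisym leading_coeff_0_iff)
  qed
  then have eq: "smult (lead_coeff f) g = smult (lead_coeff g) f" by (simp add: h_def)
  then have "Polynomial.content (smult (lead_coeff f) g) = Polynomial.content (smult (lead_coeff g) f)" by simp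
  then have "lead_coeff f = lead_coeff g"
    using g assms(4,5) by (simp add: content_smult_int)
  then have "smult (lead_coeff f) g = smult (lead_coeff f) f" using eq by simp
  moreover have "lead_coeff f \<noteq> 0" using assms(2) by simp
  ultimately show "g = f" by (rule injD[OF smult_inj, rotated])
qed

text \<open>The description is satisfied by the primitive part, with its sign adjusted, of an
  integer polynomial of least degree vanishing at \<alpha>.\<close>

lemma min_int_poly:
  assumes "algebraic \<alpha>"
  shows "poly (of_int_poly (min_int_poly \<alpha>)) \<alpha> = 0"
    and "\<And>g. g \<noteq> 0 \<Longrightarrow> poly (of_int_poly g) \<alpha> = 0 \<Longrightarrow> degree (min_int_poly \<alpha>) \<le> degree g"
    and "Polynomial.content (min_int_poly \<alpha>) = 1"
proof -
  define V where "V p \<longleftrightarrow> p \<noteq> 0 \<and> poly (of_int_poly p) \<alpha> = 0" for p :: "int poly"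
  have "\<exists>p. V p" using algebraicE'[OF assms] unfolding V_def by metis
  then obtain m where m: "V m" "\<And>q. V q \<Longrightarrow> degree m \<le> degree q"
    using ex_has_least_nat[of V _ degree] by blast
  define f where "f = smult (sgn (lead_coeff m)) (primitive_part m)"
  have m0: "m \<noteq> 0" using m(1) by (simp add: V_def)
  have "smult (Polynomial.content m) (primitive_part m) = m" by simp
  then have "of_int (Polynomial.content m) * poly (of_int_poly (primitive_part m)) \<alpha> = poly (of_int_poly m) \<alpha>"
    by (metis of_int_hom.map_poly_hom_smult poly_smult)
  then have root: "poly (of_int_poly f) \<alpha> = 0"
    using m(1) m0 by (simp add: V_def f_def hom_distribs)
  have deg: "degree f = degree m" using m0 by (simp add: f_def sgn_if)
  have lc: "lead_coeff f > 0"
  proof -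
    have "lead_coeff m = Polynomial.content m * lead_coeff (primitive_part m)"
      by (metis content_times_primitive_part lead_coeff_smult)
    moreover have "Polynomial.content m > 0" using m0 content_ge_0_int[of m] by (simp add: le_less)
    ultimately have "sgn (lead_coeff m) = sgn (lead_coeff (primitive_part m))"
      by (simp add: sgn_mult)
    then have "lead_coeff f = \<bar>lead_coeff (primitive_part m)\<bar>" 
      unfolding f_def lead_coeff_smult by (simp add: abs_sgn)
    moreover have "lead_coeff (primitive_part m) \<noteq> 0"
      unfolding leading_coeff_0_iff using m0 by simp
    ultimately show ?thesis by (simp only: zero_less_abs_iff not_False_eq_True)
  qed
  have cont: "Polynomial.content f = 1" using m0 by (simp add: f_def sgn_if content_smult_int)
  have min: "degree f \<le> degree g" if "g \<noteq> 0" "poly (of_int_poly g) \<alpha> = 0" for g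
    using m(2)[of g] that unfolding deg V_def by blast
  have "min_int_poly \<alpha> = f"
    using root lc min cont by (intro min_int_poly_eqI) auto
  then show "poly (of_int_poly (min_int_poly \<alpha>)) \<alpha> = 0" "Polynomial.content (min_int_poly \<alpha>) = 1"
    "\<And>g. g \<noteq> 0 \<Longrightarrow> poly (of_int_poly g) \<alpha> = 0 \<Longrightarrow> degree (min_int_poly \<alpha>) \<le> degree g"
    using root cont min by auto
qed

lemma is_unit_of_primitive_factor:
  fixes f :: "int poly"
  assumes "Polynomial.content f = 1" "f = g * h" "degree h = 0"
  shows "h dvd 1"
proof -
  obtain c where "h = [:c:]" using assms(3) by (rule degree_eq_zeroE)
  moreover have "Polynomial.content h = 1" using content_dvd_1[OF assms(1)] assms(2) by simp
  ultimately show ?thesis by (simp add: is_unit_const_poly_iff)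
qed

text \<open>In a factorisation one factor vanishes at \<alpha> and so has full degree; the other is
  a constant of content 1.\<close>

lemma irreducible_min_int_poly:
  assumes "algebraic \<alpha>"
  shows "irreducible (min_int_poly \<alpha>)"
proof -
  let ?f = "min_int_poly \<alpha>"
  have f0: "?f \<noteq> 0" using min_int_poly(3)[OF assms] by auto
  have unit: "h dvd 1" if gh: "?f = g * h" "poly (of_int_poly g) \<alpha> = 0" for g h
  proof -
    have gh0: "g \<noteq> 0" "h \<noteq> 0" using gh f0 by auto
    have "degree ?f \<le> degree g" using min_int_poly(2)[OF assms gh0(1) gh(2)] .
    then have "degree h = 0" using gh0 unfolding gh(1) by (simp add: degree_mult_eq)
    then show ?thesis using is_unit_of_primitive_factor[OF min_int_poly(3)[OF assms] gh(1)] by blast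
  qed
  show ?thesis
  proof (rule Factorial_Ring.irreducibleI)
    show "?f \<noteq> 0" by (rule f0)
    show "\<not> ?f dvd 1"
    proof
      assume "?f dvd 1"
      then obtain c where "?f = [:c:]" by (auto simp: is_unit_poly_iff)
      then show False using min_int_poly(1)[OF assms] f0 by simp
    qed
    show "g dvd 1 \<or> h dvd 1" if "?f = g * h" for g h
    proof -
      have "poly (of_int_poly g) \<alpha> * poly (of_int_poly h) \<alpha> = 0"
        using min_int_poly(1)[OF assms] unfolding that by (simp add: hom_distribs)
      then show ?thesis using unit[of g h] unit[of h g] that by (auto simp: mult.commute)
    qed
  qed
qed

lemma min_int_poly_irreducible:
  assumes "irreducible f" "degree f \<noteq> 0" "poly (of_int_poly f) \<alpha> = 0"
  shows "min_int_poly \<alpha> = f \<or> min_int_poly \<alpha> = - f"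
proof -
  have "Polynomial.content f = 1" using irreducible_imp_primitive[OF assms(1,2)] by simp
  moreover have "f \<noteq> 0" using assms(2) by auto
  moreover have "degree f \<le> degree g" if "g \<noteq> 0" "poly (of_int_poly g) \<alpha> = 0" for g
    using irreducible_int_poly_degree_le[OF assms(1,3) that(2,1)] .
  ultimately show ?thesis
    using min_int_poly_eqI[of f \<alpha>] min_int_poly_eqI[of "- f" \<alpha>] assms(3)
    by (cases "lead_coeff f > 0") (auto simp: hom_distribs content_smult_int[of "-1", simplified] not_less le_less)
qed

section \<open>The list of candidates\<close>

text \<open>Mignotte's bound limits each coefficient by a binomial coefficient, at most
  \<open>2 ^ 3\<close>, times the Mahler measure; \<open>8 * 8.5 = 68\<close>.\<close>

lemma finite_candidate_cubics: "finite candidate_cubics"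
proof (rule finite_subset)
  let ?I = "{- 68..68::int}"
  show "candidate_cubics \<subseteq> (\<lambda>(a, b, c, d). [:a, b, c, d:]) ` (?I \<times> ?I \<times> ?I \<times> ?I)"
  proof
    fix f assume "f \<in> candidate_cubics"
    then have f: "degree f = 3" "mahler_measure f < 8.5" by (auto simp: candidate_cubics_def)
    have "coeff f k \<in> ?I" for k
    proof -
      have "degree f choose k \<le> 2 ^ degree f" by (rule binomial_le_pow2)
      then have "real (degree f choose k) \<le> 8" using f(1) by simp
      then have "real (degree f choose k) * mahler_measure f \<le> 8 * 8.5"
        using f(2) mahler_measure_ge_0[of f] by (intro mult_mono) auto
      then have "of_int \<bar>coeff f k\<bar> \<le> (68 :: real)"
        using Mignotte_bound[of f k] by linarith
      then show ?thesis by auto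
    qed
    then show "f \<in> (\<lambda>(a, b, c, d). [:a, b, c, d:]) ` (?I \<times> ?I \<times> ?I \<times> ?I)"
      by (subst cubic_eq_coeffs[OF f(1)]) (rule image_eqI[of _ _ "(coeff f 0, coeff f 1, coeff f 2, coeff f 3)"], auto)
  qed
qed simp

lemma mahler_measure_uminus: "mahler_measure (- f) = mahler_measure f"
proof -
  have "of_int_poly (- f) = [:- 1 :: complex:] * of_int_poly f" by (simp add: hom_distribs)
  then show ?thesis
    unfolding mahler_measure_def by (simp only: measure_eq_prod mahler_measure_constant) simp
qed

lemma mahler_measure_pos:
  assumes "f \<noteq> 0"
  shows "mahler_measure f > 0"
  using mahler_measure_poly_ge_1[of f] assms by linarith

lemma not_is_cyclotomic:
  assumes "irreducible f" "degree f = 3"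
  shows "\<not> is_cyclotomic f"
proof
  assume "is_cyclotomic f"
  then obtain n where n: "n > 0" "of_int_poly f = cyclotomic_poly n \<or> of_int_poly f = - cyclotomic_poly n"
    by (auto simp: is_cyclotomic_def)
  define S where "S = {k. k \<in> {1..n} \<and> gcd k n = 1}"
  have fin: "finite S" by (rule finite_subset[of _ "{1..n}"]) (auto simp: S_def)
  have deg: "degree (cyclotomic_poly n) = 3"
  proof -
    have "degree (of_int_poly f :: complex poly) = 3" using assms(2) by simp
    then show ?thesis using n(2) by (metis degree_minus)
  qed
  have "S \<noteq> {}"
  proof
    assume "S = {}"
    then have "cyclotomic_poly n = 1" unfolding cyclotomic_poly_def S_def by (simp only: prod.empty)
    then show False using deg by simp
  qed
  then obtain k where k: "k \<in> S" by blast
  define \<alpha> where "\<alpha> = cis (2 * pi * real k / real n)"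
  have "poly (cyclotomic_poly n) \<alpha> = (\<Prod>k\<in>S. poly [:- cis (2 * pi * real k / real n), 1:] \<alpha>)"
    unfolding cyclotomic_poly_def S_def by (rule poly_prod)
  also have "\<dots> = 0" using fin k by (intro prod_zero) (auto simp: \<alpha>_def)
  finally have "poly (of_int_poly f) \<alpha> = 0" using n(2) by auto
  then have "\<not> root_of_unity \<alpha>"
    using irreducible_odd_degree_not_root_of_unity[OF assms(1)] assms(2) by simp
  moreover have "\<alpha> ^ n = cis (2 * pi * real k)"
    unfolding \<alpha>_def Complex.DeMoivre using n(1) by simp
  then have "\<alpha> ^ n = 1" by (simp add: cis_multiple_2pi)
  ultimately show False using n(1) unfolding root_of_unity_def by blast
qed

lemma candidate_cubics_iff:
  "f \<in> candidate_cubics \<longleftrightarrow> degree f = 3 \<and> irreducible f \<and> mahler_measure f < 8.5"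
  using not_is_cyclotomic by (auto simp: candidate_cubics_def)

text \<open>A proper factorisation of a primitive cubic has a linear factor. As \<open>q\<close>
  does not divide the leading coefficient, that factor has a root modulo \<open>q\<close>.\<close>

lemma irreducible_cubicI:
  fixes f :: "int poly" and q :: int
  assumes "degree f = 3" "Polynomial.content f = 1" "prime q" "\<not> q dvd lead_coeff f"
    "\<And>x. x \<in> {0..<q} \<Longrightarrow> \<not> q dvd poly f x"
  shows "irreducible f"
proof -
  have no_root: "\<not> q dvd poly f x" for x
  proof -
    have "q > 0" using assms(3) by (rule prime_gt_0_int)
    then have "\<not> q dvd poly f (x mod q)" using assms(5) by simp
    moreover have "[poly f (x mod q) = poly f x] (mod q)" by (rule cong_poly) simp
    ultimately show ?thesis by (simp add: cong_dvd_iff)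
  qed
  have f0: "f \<noteq> 0" using assms(1) by auto
  have no_linear: "degree g \<noteq> 1" if "f = g * h" for g h
  proof
    assume "degree g = 1"
    then obtain c d where g: "g = [:c, d:]" "d \<noteq> 0" using degree1_coeffs by metis
    have "lead_coeff f = d * lead_coeff h" unfolding that lead_coeff_mult using g by simp
    then have "\<not> q dvd d" using assms(4) by auto
    then have "Rings.coprime d q" using assms(3) by (metis prime_imp_coprime Rings.coprime_commute)
    then obtain x where "[d * x = 1] (mod q)" using cong_solve_coprime_int by blast
    then have "[d * x * (- c) = 1 * (- c)] (mod q)" by (rule Cong.cong_scalar_right)
    then have "q dvd c + (x * (- c)) * d" by (simp add: cong_iff_dvd_diff algebra_simps)
    then have "q dvd poly f (x * (- c))" unfolding that g(1) poly_mult by (intro dvd_mult2) simp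
    then show False using no_root by blast
  qed
  have unit: "h dvd 1" if "f = g * h" "degree h = 0" for g h
    using is_unit_of_primitive_factor[OF assms(2)] that by blast
  show ?thesis
  proof (rule Factorial_Ring.irreducibleI)
    show "\<not> f dvd 1" using assms(1) unfolding poly_dvd_1 by simp
    show "g dvd 1 \<or> h dvd 1" if gh: "f = g * h" for g h
    proof -
      have "g \<noteq> 0" "h \<noteq> 0" using f0 gh by auto
      then have "degree g + degree h = 3" using assms(1) gh by (simp add: degree_mult_eq)
      moreover have "degree g \<noteq> 1" "degree h \<noteq> 1"
        using no_linear[OF gh] no_linear[of h g] gh by (auto simp: mult.commute)
      ultimately have "degree g = 0 \<or> degree h = 0" by arith
      then show ?thesis using unit[of g h] unit[of h g] gh by (auto simp: mult.commute)
    qed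
  qed (rule f0)
qed

section \<open>Splitting and Mahler measure of the cyclic cubics\<close>

text \<open>The three roots are the orbit of \<open>x\<close> under the map of order 3; Vieta's
  formulas are checked after clearing denominators.\<close>

lemma cyclic_cubic_factor:
  fixes x :: "'a::field"
  assumes "poly (of_int_poly (cyclic_cubic a b)) x = 0" "(of_int a :: 'a) \<noteq> 0"
  shows "of_int_poly (cyclic_cubic a b) = smult (of_int a) (\<Prod>r\<leftarrow>[x, - 1 / (1 + x), - (1 + x) / x]. [:- r, 1:])"
proof -
  define A B :: 'a where "A = of_int a" and "B = of_int b"
  have 0: "A * x ^ 3 + B * x\<^sup>2 + (B - 3 * A) * x - A = 0"
    using assms(1) unfolding poly_cyclic_cubic A_def B_def .
  have A0: "A \<noteq> 0" using assms(2) by (simp add: A_def)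
  \<comment> \<open>The denominators are nonzero because the cubic takes the values
    \<open>- A\<close> at 0 and \<open>A\<close> at -1.\<close>
  have x0: "x \<noteq> 0" using 0 A0 by auto
  have x1: "1 + x \<noteq> 0"
  proof
    assume "1 + x = 0"
    then have "x = - 1" by (simp add: add_eq_0_iff)
    then show False using 0 A0 by (simp add: power2_eq_square power3_eq_cube algebra_simps)
  qed
  have xx: "x * (1 + x) \<noteq> 0" using x0 x1 by simp
  define y z where "y = - 1 / (1 + x)" and "z = - (1 + x) / x"
  have y: "y * (1 + x) = - 1" and z: "z * x = - (1 + x)"
    using x0 x1 by (simp_all add: y_def z_def)
  have "x * (1 + x) * (A * (x + y + z)) = A * (x * x * (1 + x) + x * (y * (1 + x)) + (1 + x) * (z * x))"
    by (simp add: algebra_simps)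
  also have "\<dots> = x * (1 + x) * (- B)"
    unfolding y z using 0 by (simp add: algebra_simps power2_eq_square power3_eq_cube)
  finally have e1: "A * (x + y + z) = - B" using xx mult_left_cancel by blast
  have "x * (1 + x) * (A * (x * y + x * z + y * z)) =
      A * (x * x * (y * (1 + x)) + x * (1 + x) * (z * x) + (y * (1 + x)) * (z * x))"
    by (simp add: algebra_simps)
  also have "\<dots> = x * (1 + x) * (B - 3 * A)"
    unfolding y z using 0 by (simp add: algebra_simps power2_eq_square power3_eq_cube)
  finally have e2: "A * (x * y + x * z + y * z) = B - 3 * A" using xx mult_left_cancel by blast
  have "(1 + x) * (A * (x * y * z)) = A * ((y * (1 + x)) * (z * x))" by (simp add: algebra_simps)
  also have "\<dots> = (1 + x) * A" unfolding y z by (simp add: algebra_simps)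
  finally have e3: "A * (x * y * z) = A" using x1 mult_left_cancel by blast
  have "smult A (\<Prod>r\<leftarrow>[x, y, z]. [:- r, 1:]) =
      [:- (A * (x * y * z)), A * (x * y + x * z + y * z), - (A * (x + y + z)), A:]"
    by (simp add: algebra_simps)
  also have "\<dots> = of_int_poly (cyclic_cubic a b)"
    unfolding e1 e2 e3 by (simp add: cyclic_cubic_def hom_distribs A_def B_def)
  finally show ?thesis
    unfolding y_def z_def A_def by simp
qed

text \<open>For positive \<open>x\<close>, the root \<open>- 1 / (1 + x)\<close> lies inside the
  unit disc and \<open>- (1 + x) / x\<close> outside, which leaves
  \<open>a * max 1 x * (1 + x) / x\<close>.\<close>

lemma mahler_measure_cyclic_cubic:
  fixes x :: real
  assumes "poly (of_int_poly (cyclic_cubic a b)) x = 0" "a > 0" "x > 0"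
  shows "mahler_measure (cyclic_cubic a b) = a * max (1 + x) (1 + 1 / x)"
proof -
  have "poly (of_int_poly f) (of_real y :: complex) = of_real (poly (of_int_poly f) y)" for f y
    by (induction f) (simp_all add: hom_distribs)
  then have "poly (of_int_poly (cyclic_cubic a b)) (of_real x :: complex) = 0"
    using assms(1) by simp
  from cyclic_cubic_factor[OF this]
  have "of_int_poly (cyclic_cubic a b) = smult (of_int a)
      (\<Prod>r\<leftarrow>map of_real [x, - 1 / (1 + x), - (1 + x) / x]. [:- r, 1 :: complex:])"
    using assms(2) by simp
  then have "mahler_measure (cyclic_cubic a b) =
      cmod (of_int a) * (\<Prod>r\<leftarrow>map of_real [x, - 1 / (1 + x), - (1 + x) / x]. max 1 (cmod r))"
    unfolding mahler_measure_def by (simp only: mahler_measure_poly_explicit)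
  also have "\<dots> = a * (max 1 \<bar>x\<bar> * (max 1 \<bar>- 1 / (1 + x)\<bar> * max 1 \<bar>- (1 + x) / x\<bar>))"
    unfolding list.map prod_list.Cons prod_list.Nil norm_of_real using assms(2) by simp
  also have "\<bar>x\<bar> = x" using assms(3) by simp
  also have "max 1 \<bar>- 1 / (1 + x)\<bar> = 1"
  proof -
    have "\<bar>- 1 / (1 + x)\<bar> = 1 / (1 + x)" using assms(3) by simp
    also have "\<dots> \<le> 1" using assms(3) by simp
    finally show ?thesis by simp
  qed
  also have "max 1 \<bar>- (1 + x) / x\<bar> = (1 + x) / x"
  proof -
    have "\<bar>- (1 + x) / x\<bar> = (1 + x) / x"
      unfolding minus_divide_left[symmetric] abs_minus_cancel using assms(3) by simp
    moreover have "1 \<le> (1 + x) / x" using assms(3) by simp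
    ultimately show ?thesis by simp
  qed
  also have "max 1 x * (1 * ((1 + x) / x)) = max (1 + x) (1 + 1 / x)"
  proof (cases "x \<ge> 1")
    case True
    then have "1 / x \<le> x" using assms(3) by (simp add: divide_le_eq mult_le_cancel_left1 order_trans[of 1 x])
    then show ?thesis using True by simp
  next
    case False
    then have "x \<le> 1 / x" using assms(3) by (simp add: le_divide_eq mult_le_one)
    then show ?thesis using False assms(3) by (simp add: add_divide_distrib)
  qed
  finally show ?thesis .
qed

lemma mahler_measure_cyclic_cubic_less:
  fixes l u c :: real
  assumes "poly (of_int_poly (cyclic_cubic a b)) l < 0" "poly (of_int_poly (cyclic_cubic a b)) u > 0"
    "a > 0" "0 < l" "l < u" "a * (1 + u) \<le> c" "a * (1 + 1 / l) \<le> c"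
  shows "mahler_measure (cyclic_cubic a b) < c"
proof -
  obtain x where x: "l < x" "x < u" "poly (of_int_poly (cyclic_cubic a b)) x = 0"
    using poly_IVT_pos[OF assms(5,1,2)] by blast
  have "1 / x < 1 / l" using x assms(4) by (simp add: frac_less2)
  then have "max (1 + x) (1 + 1 / x) < max (1 + u) (1 + 1 / l)" using x by auto
  then have "a * max (1 + x) (1 + 1 / x) < a * max (1 + u) (1 + 1 / l)" using assms(3) by simp
  also have "\<dots> \<le> c" using assms(6,7) by (auto simp: max_def)
  finally show ?thesis
    using mahler_measure_cyclic_cubic[OF x(3) assms(3)] x(1) assms(4) by simp
qed

lemma cyclic_cubic_candidateI:
  fixes a b q :: int and l u :: real
  assumes "a > 0" "gcd a b = 1" "prime q" "\<not> q dvd a"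
    "\<And>x. x \<in> {0..<q} \<Longrightarrow> \<not> q dvd a * x ^ 3 + b * x\<^sup>2 + (b - 3 * a) * x - a"
    "a * l ^ 3 + b * l\<^sup>2 + (b - 3 * a) * l - a < 0" "a * u ^ 3 + b * u\<^sup>2 + (b - 3 * a) * u - a > 0"
    "0 < l" "l < u" "a * (1 + u) \<le> 8.5" "a * (1 + 1 / l) \<le> 8.5"
  shows "cyclic_cubic a b \<in> candidate_cubics"
proof -
  have deg: "degree (cyclic_cubic a b) = 3" and lc: "lead_coeff (cyclic_cubic a b) = a"
    using assms(1) by (auto simp: cyclic_cubic_def)
  have poly: "poly (cyclic_cubic a b) x = a * x ^ 3 + b * x\<^sup>2 + (b - 3 * a) * x - a" for x
    using poly_cyclic_cubic[of a b x] by simp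
  have content: "Polynomial.content (cyclic_cubic a b) = 1"
  proof -
    have "Polynomial.content (cyclic_cubic a b) dvd coeff (cyclic_cubic a b) n" for n
      by (rule content_dvd_coeff)
    from this[of 3] this[of 2] have "Polynomial.content (cyclic_cubic a b) dvd gcd a b"
      by (simp add: cyclic_cubic_def numeral_2_eq_2 numeral_3_eq_3)
    then show ?thesis using assms(2) content_ge_0_int[of "cyclic_cubic a b"] by simp
  qed
  have "irreducible (cyclic_cubic a b)"
    by (rule irreducible_cubicI[OF deg content assms(3)]) (use assms(4,5) lc in \<open>simp_all only: poly not_False_eq_True\<close>)
  moreover have "mahler_measure (cyclic_cubic a b) < 8.5"
    by (rule mahler_measure_cyclic_cubic_less[of a b l u]) (use assms in \<open>simp_all add: poly_cyclic_cubic\<close>)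
  ultimately show ?thesis unfolding candidate_cubics_iff using deg by blast
qed

lemma cyclic_cubic_candidate:
  assumes "(a, b) \<in> {(1, 0), (1, 1), (1, -6), (2, 9)}"
  shows "cyclic_cubic a b \<in> candidate_cubics"
proof -
  have q2: "x = 0 \<or> x = 1" if "x \<in> {0..<2}" for x :: int using that by auto
  have q5: "x = 0 \<or> x = 1 \<or> x = 2 \<or> x = 3 \<or> x = 4" if "x \<in> {0..<5}" for x :: int using that by auto
  have "cyclic_cubic 1 0 \<in> candidate_cubics"
    by (rule cyclic_cubic_candidateI[of 1 0 2 1 2]) (use q2 in fastforce)+
  moreover have "cyclic_cubic 1 1 \<in> candidate_cubics"
    by (rule cyclic_cubic_candidateI[of 1 1 2 1 2]) (use q2 in fastforce)+
  moreover have "cyclic_cubic 1 (- 6) \<in> candidate_cubics"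
    \<comment> \<open>The positive root lies below 7.4, which bounds the Mahler measure by
      8.4.\<close>
    by (rule cyclic_cubic_candidateI[of 1 "- 6" 2 1 "7.4"])
      (use q2 in \<open>fastforce simp: power2_eq_square power3_eq_cube\<close>)+
  \<comment> \<open>The prime 2 divides the leading coefficient, and 1 is a root modulo 3, hence the
    choice of 5. The lower bound 0.32 gives \<open>2 * (1 + 1 / 0.32) = 8.25\<close>.\<close>
  moreover have "cyclic_cubic 2 9 \<in> candidate_cubics"
    by (rule cyclic_cubic_candidateI[of 2 9 5 "0.32" "0.33"])
      (use q5 in \<open>fastforce simp: power2_eq_square power3_eq_cube\<close>)+
  ultimately show ?thesis using assms by auto
qed

lemma splits_completely_smult:
  assumes "splits_completely f"
  shows "splits_completely (smult c f)"
proof -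
  obtain c' rs where "f = smult c' (\<Prod>r\<leftarrow>rs. [:- r, 1:])"
    using assms unfolding splits_completely_def by blast
  then have "smult c f = smult (c * c') (\<Prod>r\<leftarrow>rs. [:- r, 1:])" by simp
  then show ?thesis unfolding splits_completely_def by blast
qed

text \<open>This is what makes the algorithm terminate: some entry of the list splits, whatever the
  prime.\<close>

lemma ex_cyclic_cubic_splits:
  assumes "odd CARD('p::prime_card)" "[CARD('p) = 2] (mod 3)"
  shows "\<exists>f\<in>candidate_cubics. splits_completely (of_int_poly f :: 'p padic poly)"
proof -
  obtain a b and x :: "'p mod_ring" where ab: "(a, b) \<in> {(1, 0), (1, 1), (1, -6), (2, 9)}"
    and x: "poly (of_int_poly (cyclic_cubic a b)) x = 0"
    by (rule bexE[OF ex_root_mod_ring[OF assms]]) (auto simp only: split: prod.splits)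
  have a: "a = 1 \<or> a = 2" using ab by auto
  obtain k where k: "x = of_int k" using ex_of_int_mod_ring by blast
  let ?f = "cyclic_cubic a b"
  have hom: "poly (of_int_poly g) (of_int k :: 'p mod_ring) = of_int (poly g k)" for g
    by (induction g) (simp_all add: hom_distribs)
  have "int CARD('p) dvd poly ?f k"
    using x unfolding k hom of_int_mod_ring_eq_0_iff .
  moreover have "\<not> int CARD('p) dvd poly (pderiv ?f) k"
    using cyclic_cubic_deriv_neq_0[OF assms a x] unfolding k hom of_int_mod_ring_eq_0_iff .
  ultimately obtain z :: "'p padic_int" where z: "poly (of_int_poly ?f) z = 0"
    using hensel_padic_int by blast
  have "poly (of_int_poly g) (to_fract y) = to_fract (poly (of_int_poly g) y)" for g and y :: "'p padic_int"
    by (induction g) (simp_all add: hom_distribs)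
  then have "poly (of_int_poly ?f) (to_fract z) = 0" using z by simp
  moreover have "(of_int a :: 'p padic) \<noteq> 0" using a by auto
  ultimately have "splits_completely (of_int_poly ?f :: 'p padic poly)"
    unfolding splits_completely_def using cyclic_cubic_factor by blast
  then show ?thesis using cyclic_cubic_candidate[OF ab] by blast
qed

section \<open>Heights of roots and correctness of the algorithm\<close>

text \<open>The minimal polynomial is \<open>f\<close> or \<open>- f\<close>, and the sign changes
  neither the Mahler measure nor splitting.\<close>

lemma weil_height_root_cubic:
  assumes "irreducible f" "degree f = 3" "poly (of_int_poly f) \<alpha> = 0"
  shows "alg_degree \<alpha> = 3" "\<alpha> \<noteq> 0" "\<not> root_of_unity \<alpha>"
    "weil_height \<alpha> = 1 / 3 * ln (mahler_measure f)"
    "totally_padic TYPE('p::prime_card) \<alpha> \<longleftrightarrow> splits_completely (of_int_poly f :: 'p padic poly)"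
proof -
  have m: "min_int_poly \<alpha> = f \<or> min_int_poly \<alpha> = - f"
    using min_int_poly_irreducible[OF assms(1) _ assms(3)] assms(2) by simp
  then show deg: "alg_degree \<alpha> = 3" using assms(2) by (auto simp: alg_degree_def)
  show "\<not> root_of_unity \<alpha>"
    using irreducible_odd_degree_not_root_of_unity[OF assms(1) _ _ assms(3)] assms(2) by simp
  have "mahler_measure (min_int_poly \<alpha>) = mahler_measure f" using m mahler_measure_uminus by auto
  then show "weil_height \<alpha> = 1 / 3 * ln (mahler_measure f)"
    unfolding weil_height_def deg by simp
  show "\<alpha> \<noteq> 0"
  proof
    assume "\<alpha> = 0"
    then have "coeff f 0 = 0" using assms(3) by (simp add: poly_0_coeff_0)
    then have "poly (of_int_poly f) (0 :: rat) = 0" by (simp add: poly_0_coeff_0)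
    then show False using irreducible_int_poly_no_rat_root[OF assms(1), of 0] assms(2) by simp
  qed
  have "algebraic \<alpha>"
    using assms(2,3) by (intro algebraicI[of "of_int_poly f"]) auto
  moreover have "of_int_poly (- f) = smult (- 1) (of_int_poly f :: 'p padic poly)"
    "of_int_poly f = smult (- 1) (of_int_poly (- f) :: 'p padic poly)"
    by (simp_all add: hom_distribs)
  then have "splits_completely (of_int_poly (- f) :: 'p padic poly) \<longleftrightarrow> splits_completely (of_int_poly f :: 'p padic poly)"
    using splits_completely_smult by metis
  ultimately show "totally_padic TYPE('p) \<alpha> \<longleftrightarrow> splits_completely (of_int_poly f :: 'p padic poly)"
    unfolding totally_padic_def using m by metis
qed

lemma find_sorted_min:
  fixes \<mu> :: "'a \<Rightarrow> 'b::linorder"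
  assumes "sorted (map \<mu> xs)" "x \<in> set xs" "P x"
  obtains y where "find P xs = Some y" "y \<in> set xs" "P y" "\<And>z. z \<in> set xs \<Longrightarrow> P z \<Longrightarrow> \<mu> y \<le> \<mu> z"
proof -
  have "find P xs \<noteq> None" using assms(2,3) by (auto simp: find_None_iff)
  then obtain y where y: "find P xs = Some y" by blast
  then obtain i where i: "i < length xs" "P (xs ! i)" "y = xs ! i" "\<And>j. j < i \<Longrightarrow> \<not> P (xs ! j)"
    by (auto simp: find_Some_iff)
  have "\<mu> y \<le> \<mu> z" if z: "z \<in> set xs" "P z" for z
  proof -
    obtain j where j: "j < length xs" "z = xs ! j" using z(1) by (auto simp: in_set_conv_nth)
    then have "i \<le> j" using i(4) z(2) by (metis not_less)
    then show ?thesis using sorted_nth_mono[OF assms(1), of i j] i j by simp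
  qed
  then show ?thesis using that y i by auto
qed

theorem theorem12:
  assumes "odd CARD('p::prime_card)" and "[CARD('p) = 2] (mod 3)"
  shows "(\<exists>fs. ascending_list fs) \<and>
    (\<forall>fs (rt :: int poly \<Rightarrow> 'p padic alg_closure).
       ascending_list fs \<and> sqrt_choice rt \<longrightarrow> algorithm rt fs = Some (tau TYPE('p) 3))"
proof (intro conjI allI impI)
  obtain xs where xs: "set xs = candidate_cubics" "distinct xs"
    using finite_distinct_list[OF finite_candidate_cubics] by blast
  then have "ascending_list (sort_key mahler_measure xs)" by (simp add: ascending_list_def)
  then show "\<exists>fs. ascending_list fs" ..
next
  fix fs and rt :: "int poly \<Rightarrow> 'p padic alg_closure"
  assume "ascending_list fs \<and> sqrt_choice rt"
  then have fs: "set fs = candidate_cubics" "sorted (map mahler_measure fs)" and rt: "sqrt_choice rt"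
    by (auto simp: ascending_list_def)
  \<comment> \<open>For candidates, both sides are equivalent to the same parametrization of
    \<open>A\<close> and \<open>B\<close> by \<open>m\<close> and \<open>n\<close>.\<close>
  have accepts: "accepts rt f \<longleftrightarrow> splits_completely (of_int_poly f :: 'p padic poly)"
    if "f \<in> candidate_cubics" for f
  proof -
    have f: "irreducible f" "degree f = 3" using that unfolding candidate_cubics_iff by blast+
    show ?thesis
      unfolding accepts_iff[OF square_neq_minus_3_padic[OF assms] rt Delta_neq_0[OF f]]
        splits_completely_iff_depressed[OF f(2)] ..
  qed
  obtain f0 where f0: "f0 \<in> set fs" "accepts rt f0"
    using ex_cyclic_cubic_splits[OF assms] accepts unfolding fs(1) by blast
  obtain f where f: "find (accepts rt) fs = Some f" "f \<in> candidate_cubics" "accepts rt f"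
    and min: "\<And>g. g \<in> candidate_cubics \<Longrightarrow> accepts rt g \<Longrightarrow> mahler_measure f \<le> mahler_measure g"
    using find_sorted_min[of mahler_measure fs f0 "accepts rt"] fs(2) f0 unfolding fs(1) by blast
  have f': "degree f = 3" "irreducible f" "mahler_measure f < 8.5"
    using f(2) unfolding candidate_cubics_iff by blast+
  have "f \<noteq> 0" using f'(1) by auto
  then have pos: "mahler_measure f > 0" by (rule mahler_measure_pos)
  have "tau TYPE('p) 3 = 1 / 3 * ln (mahler_measure f)"
    unfolding tau_def
  proof (rule Least_equality)
    have "\<not> constant (poly (of_int_poly f :: complex poly))"
      using f'(1) by (simp add: constant_degree)
    then obtain \<alpha> :: complex where \<alpha>: "poly (of_int_poly f) \<alpha> = 0"
      using fundamental_theorem_of_algebra by blast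
    note root = weil_height_root_cubic[OF f'(2,1) \<alpha>]
    have "totally_padic TYPE('p) \<alpha>" using root(5) accepts[OF f(2)] f(3) by blast
    then show "\<exists>\<alpha>. totally_padic TYPE('p) \<alpha> \<and> alg_degree \<alpha> = 3 \<and> \<alpha> \<noteq> 0 \<and> \<not> root_of_unity \<alpha> \<and>
        1 / 3 * ln (mahler_measure f) = weil_height \<alpha>"
      using root(1-4) by metis
  next
    fix h
    assume "\<exists>\<alpha>. totally_padic TYPE('p) \<alpha> \<and> alg_degree \<alpha> = 3 \<and> \<alpha> \<noteq> 0 \<and> \<not> root_of_unity \<alpha> \<and> h = weil_height \<alpha>"
    then obtain \<alpha> where \<alpha>: "totally_padic TYPE('p) \<alpha>" "alg_degree \<alpha> = 3" "h = weil_height \<alpha>" by blast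
    define g where "g = min_int_poly \<alpha>"
    have "algebraic \<alpha>" using \<alpha>(1) by (simp add: totally_padic_def)
    then have g: "irreducible g" "degree g = 3"
      using irreducible_min_int_poly \<alpha>(2) by (auto simp: g_def alg_degree_def)
    have split: "splits_completely (of_int_poly g :: 'p padic poly)"
      using \<alpha>(1) by (simp add: totally_padic_def g_def)
    \<comment> \<open>A competitor missing from the list has Mahler measure at least 8.5, which
      exceeds that of \<open>f\<close>.\<close>
    have "mahler_measure f \<le> mahler_measure g"
    proof (cases "mahler_measure g < 8.5")
      case True
      then have "g \<in> candidate_cubics" using g candidate_cubics_iff by blast
      then show ?thesis using min accepts split by blast
    qed (use f'(3) in linarith)
    then show "1 / 3 * ln (mahler_measure f) \<le> h"
      unfolding \<alpha>(3) weil_height_def \<alpha>(2) g_def[symmetric] using pos by simp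
  qed
  then show "algorithm rt fs = Some (tau TYPE('p) 3)"
    by (simp add: algorithm_eq_find f(1))
qed

end
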